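(* Let $\kappa$ be an infinite regular cardinal. (A) Let $\mathcal{C}$ be a $\kappa$-bounded category satisfying the amalgamation property and the joint embedding property. If there exists a dominating family of arrows $\mathcal{F}$ in $\mathcal{C}$ such that $|\mathcal{F}|\leq\kappa$, then for any embedding $i:\mathcal{C}\to\mathcal{D}$ such that $\mathcal{D}$ has all colimits of $\kappa$-chains in $\mathcal{C}$ and all the objects in $\mathcal{C}$ are $\kappa$-small in $\mathcal{D}$, there exists in $\mathcal{D}_{\kappa}$ a $\mathcal{C}$-homogeneous and $\mathcal{C}$-universal object. If moreover all the morphisms in $\mathcal{D}_{\kappa}^{c}$ are monic (as arrows in $\mathcal{D}_{\kappa}^{c}$), then every $\mathcal{C}$-homogeneous and $\mathcal{C}$-universal object in $\mathcal{D}_{\kappa}^{c}$ is $\mathcal{C}$-ultrahomogeneous and unique (up to isomorphism) with these properties in $\mathcal{D}_{\kappa}^{c}$. (B) Conversely, given an embedding $i:\mathcal{C}\to\mathcal{D}$ such that all the morphisms in $\mathcal{D}_{\kappa}$ are monic, if there exists in $\mathcal{D}_{\kappa}$ an object which is $\mathcal{C}$-homogeneous and $\mathcal{C}$-universal, then the category $\mathcal{C}$ satisfies the amalgamation and joint embedding properties.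
   Context: Given an embedding of categories $i:\mathcal{C}\to\mathcal{D}$, objects and arrows of $\mathcal{C}$ are identified notationally with their images in $\mathcal{D}$. Amalgamation property: for all objects $a,b,c$ and arrows $f:a\to b$, $g:a\to c$ in $\mathcal{C}$ there are an object $d$ and arrows $f':b\to d$, $g':c\to d$ in $\mathcal{C}$ with $f'\circ f=g'\circ g$. Joint embedding property: for all objects $a,b$ of $\mathcal{C}$ there are an object $c$ and arrows $a\to c$, $b\to c$ in $\mathcal{C}$. Given an embedding $i:\mathcal{C}\to\mathcal{D}$, an object $u$ of $\mathcal{D}$ is: - $\mathcal{C}$-homogeneous if for all objects $a,b\in\mathcal{C}$ and arrows $j:a\to b$ in $\mathcal{C}$ and $\chi:a\to u$ in $\mathcal{D}$ there is an arrow $\tilde\chi:b\to u$ with $\tilde\chi\circ j=\chi$; - $\mathcal{C}$-ultrahomogeneous if for all objects $a,b\in\mathcal{C}$ and arrows $j:a\to b$ in $\mathcal{C}$ and $\chi_1:a\to u$, $\chi_2:b\to u$ in $\mathcal{D}$ there is an isomorphism $\check{j}:u\to u$ with $\check{j}\circ\chi_1=\chi_2\circ j$; - $\mathcal{C}$-universal if for every $a\in\mathcal{C}$ there is an arrow $a\to u$ in $\mathcal{D}$. Dominating family: a collection $\mathcal{F}$ of arrows of $\mathcal{C}$ is dominating in $\mathcal{C}$ if the family $\mathrm{Dom}(\mathcal{F})$ of objects which are domains of an arrow in $\mathcal{F}$ is cofinal in $\mathcal{C}$ (every object of $\mathcal{C}$ admits an arrow to some object in $\mathrm{Dom}(\mathcal{F})$)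 and, for every $a\in\mathrm{Dom}(\mathcal{F})$ and every arrow $f:a\to x$ in $\mathcal{C}$, there is an arrow $g$ in $\mathcal{C}$ with domain $x$ such that $g\circ f\in\mathcal{F}$. Chains: for an ordinal $\lambda>0$, a $\lambda$-chain (chain of length $\lambda$) in $\mathcal{C}$ is a functor $\vec{u}:\lambda\to\mathcal{C}$, with $\lambda$ regarded as a poset category; write $u_j=\vec{u}(j)$. $\mathcal{C}$ is $\kappa$-bounded if every chain in $\mathcal{C}$ of length $\lambda<\kappa$ has a cocone in $\mathcal{C}$ over it. A $\kappa$-chain $\vec{u}$ in $\mathcal{C}$ is continuous if for each limit ordinal $j\in\kappa$, $u_j$ is the colimit of the restriction of $\vec{u}$ to $j$, with universal colimit arrows given by the arrows $u_i\to u_j$ ($i<j$) of the chain. Given an embedding $i:\mathcal{C}\to\mathcal{D}$, $\mathcal{D}_{\kappa}$ (respectively $\mathcal{D}_{\kappa}^{c}$) is the full subcategory of $\mathcal{D}$ on the objects that can be expressed as colimits of $\kappa$-chains (respectively continuous $\kappa$-chains) in $\mathcal{C}$. An object $a$ of $\mathcal{C}$ is $\kappa$-small in $\mathcal{D}$ if the functor $\mathrm{Hom}_{\mathcal{D}}(i(a),-):\mathcal{D}\to\mathbf{Set}$ preserves all colimits of $\kappa$-chains in $\mathcal{D}$.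
   Formalization: "Embedding" means full and faithful functor; (A) additionally assumes that C has at least one object, and (B) additionally assumes that all objects of C are κ-small in D, since the claims fail without these. *)

theory Defs
  imports Main "HOL-Library.FuncSet"
begin

unbundle cardinal_syntax

section \<open>Categories and functors\<close>

text \<open>Objects and arrows are the elements of explicit carrier sets; \<open>g \<cdot>\<^bsub>C\<^esub> f\<close> is the composite
  ``first \<open>f\<close>, then \<open>g\<close>''. Values of the operations outside the carriers are irrelevant.\<close>

record ('o, 'a) cat =
  Ob :: "'o set"
  Arr :: "'a set"
  Dom :: "'a \<Rightarrow> 'o"
  Cod :: "'a \<Rightarrow> 'o"
  Idt :: "'o \<Rightarrow> 'a"
  Cmp :: "'a \<Rightarrow> 'a \<Rightarrow> 'a"  (infixl \<open>\<cdot>\<index>\<close> 70)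

definition hom :: "('o, 'a) cat \<Rightarrow> 'o \<Rightarrow> 'o \<Rightarrow> 'a set" where
  "hom C x y = {f \<in> Arr C. Dom C f = x \<and> Cod C f = y}"

locale category =
  fixes C :: "('o, 'a) cat" (structure)
  assumes Dom_Ob: "f \<in> Arr C \<Longrightarrow> Dom C f \<in> Ob C"
    and Cod_Ob: "f \<in> Arr C \<Longrightarrow> Cod C f \<in> Ob C"
    and Idt_hom: "x \<in> Ob C \<Longrightarrow> Idt C x \<in> hom C x x"
    and Cmp_hom: "f \<in> hom C x y \<Longrightarrow> g \<in> hom C y z \<Longrightarrow> g \<cdot> f \<in> hom C x z"
    and Cmp_Idt: "f \<in> hom C x y \<Longrightarrow> f \<cdot> Idt C x = f"
    and Idt_Cmp: "f \<in> hom C x y \<Longrightarrow> Idt C y \<cdot> f = f"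
    and Cmp_assoc: "f \<in> hom C w x \<Longrightarrow> g \<in> hom C x y \<Longrightarrow> h \<in> hom C y z \<Longrightarrow>
      (h \<cdot> g) \<cdot> f = h \<cdot> (g \<cdot> f)"

record ('o, 'a, 'p, 'b) fctr =
  Fo :: "'o \<Rightarrow> 'p"
  Fa :: "'a \<Rightarrow> 'b"

definition is_functor :: "('o, 'a) cat \<Rightarrow> ('p, 'b) cat \<Rightarrow> ('o, 'a, 'p, 'b) fctr \<Rightarrow> bool" where
  "is_functor C D F \<longleftrightarrow>
     (\<forall>x \<in> Ob C. Fo F x \<in> Ob D) \<and>
     (\<forall>x y. \<forall>f \<in> hom C x y. Fa F f \<in> hom D (Fo F x) (Fo F y)) \<and>
     (\<forall>x \<in> Ob C. Fa F (Idt C x) = Idt D (Fo F x)) \<and>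
     (\<forall>x y z. \<forall>f \<in> hom C x y. \<forall>g \<in> hom C y z.
        Fa F (g \<cdot>\<^bsub>C\<^esub> f) = Fa F g \<cdot>\<^bsub>D\<^esub> Fa F f)"

definition comp_functor ::
  "('p, 'b, 'q, 'c) fctr \<Rightarrow> ('o, 'a, 'p, 'b) fctr \<Rightarrow> ('o, 'a, 'q, 'c) fctr" where
  "comp_functor G F = \<lparr>Fo = Fo G \<circ> Fo F, Fa = Fa G \<circ> Fa F\<rparr>"

definition full :: "('o, 'a) cat \<Rightarrow> ('p, 'b) cat \<Rightarrow> ('o, 'a, 'p, 'b) fctr \<Rightarrow> bool" where
  "full C D F \<longleftrightarrow> (\<forall>x \<in> Ob C. \<forall>y \<in> Ob C. hom D (Fo F x) (Fo F y) \<subseteq> Fa F ` hom C x y)"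

definition faithful :: "('o, 'a) cat \<Rightarrow> ('p, 'b) cat \<Rightarrow> ('o, 'a, 'p, 'b) fctr \<Rightarrow> bool" where
  "faithful C D F \<longleftrightarrow> (\<forall>x \<in> Ob C. \<forall>y \<in> Ob C. inj_on (Fa F) (hom C x y))"

text \<open>An embedding is a full and faithful functor, so that the arrows of \<open>C\<close> between two
  objects of \<open>C\<close> can be identified with the arrows of \<open>D\<close> between their images.\<close>

definition embedding :: "('o, 'a) cat \<Rightarrow> ('p, 'b) cat \<Rightarrow> ('o, 'a, 'p, 'b) fctr \<Rightarrow> bool" where
  "embedding C D i \<longleftrightarrow> is_functor C D i \<and> full C D i \<and> faithful C D i"

definition full_subcat :: "('o, 'a) cat \<Rightarrow> ('o \<Rightarrow> bool) \<Rightarrow> ('o, 'a) cat" where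
  "full_subcat C P =
     \<lparr>Ob = {x \<in> Ob C. P x}, Arr = {f \<in> Arr C. P (Dom C f) \<and> P (Cod C f)},
      Dom = Dom C, Cod = Cod C, Idt = Idt C, Cmp = Cmp C\<rparr>"

definition monic :: "('o, 'a) cat \<Rightarrow> 'a \<Rightarrow> bool" where
  "monic C m \<longleftrightarrow> m \<in> Arr C \<and>
     (\<forall>x. \<forall>f \<in> hom C x (Dom C m). \<forall>g \<in> hom C x (Dom C m).
        m \<cdot>\<^bsub>C\<^esub> f = m \<cdot>\<^bsub>C\<^esub> g \<longrightarrow> f = g)"

definition is_iso :: "('o, 'a) cat \<Rightarrow> 'a \<Rightarrow> bool" where
  "is_iso C f \<longleftrightarrow> f \<in> Arr C \<and>
     (\<exists>g \<in> hom C (Cod C f) (Dom C f).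
        g \<cdot>\<^bsub>C\<^esub> f = Idt C (Dom C f) \<and> f \<cdot>\<^bsub>C\<^esub> g = Idt C (Cod C f))"

definition isomorphic :: "('o, 'a) cat \<Rightarrow> 'o \<Rightarrow> 'o \<Rightarrow> bool" where
  "isomorphic C x y \<longleftrightarrow> (\<exists>f \<in> hom C x y. is_iso C f)"


section \<open>Cocones and colimits\<close>

definition cocone ::
  "('j, 'e) cat \<Rightarrow> ('o, 'a) cat \<Rightarrow> ('j, 'e, 'o, 'a) fctr \<Rightarrow> 'o \<Rightarrow> ('j \<Rightarrow> 'a) \<Rightarrow> bool" where
  "cocone J C F x \<mu> \<longleftrightarrow> x \<in> Ob C \<and>
     (\<forall>j \<in> Ob J. \<mu> j \<in> hom C (Fo F j) x) \<and>
     (\<forall>e \<in> Arr J. \<mu> (Cod J e) \<cdot>\<^bsub>C\<^esub> Fa F e = \<mu> (Dom J e))"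

definition is_colimit ::
  "('j, 'e) cat \<Rightarrow> ('o, 'a) cat \<Rightarrow> ('j, 'e, 'o, 'a) fctr \<Rightarrow> 'o \<Rightarrow> ('j \<Rightarrow> 'a) \<Rightarrow> bool" where
  "is_colimit J C F x \<mu> \<longleftrightarrow> cocone J C F x \<mu> \<and>
     (\<forall>y \<nu>. cocone J C F y \<nu> \<longrightarrow> (\<exists>!h. h \<in> hom C x y \<and> (\<forall>j \<in> Ob J. h \<cdot>\<^bsub>C\<^esub> \<mu> j = \<nu> j)))"

definition preserves_colimit :: "('j, 'e) cat \<Rightarrow> ('o, 'a) cat \<Rightarrow> ('p, 'b) cat \<Rightarrow>
    ('o, 'a, 'p, 'b) fctr \<Rightarrow> ('j, 'e, 'o, 'a) fctr \<Rightarrow> bool" where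
  "preserves_colimit J C D G F \<longleftrightarrow>
     (\<forall>x \<mu>. is_colimit J C F x \<mu> \<longrightarrow> is_colimit J D (comp_functor G F) (Fo G x) (Fa G \<circ> \<mu>))"


section \<open>Sets and hom-functors\<close>

text \<open>The category of all sets of elements of \<open>'x\<close>; an arrow is a triple (domain, function,
  codomain) whose function is extensional, i.e. \<open>undefined\<close> off its domain. It is used below with
  \<open>'x\<close> the type of arrows of the category whose hom-functors are considered. Restricting \<open>Set\<close> to
  this universe does not affect whether a cocone on such hom-sets is a colimit: a map of sets
  \<open>L \<rightarrow> X\<close> is bijective as soon as it induces a bijection on maps into a fixed two-element set;
  and if the type of arrows has only one element, all these hom-sets are singletons.\<close>

definition set_cat :: "('x set, 'x set \<times> ('x \<Rightarrow> 'x) \<times> 'x set) cat" where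
  "set_cat =
     \<lparr>Ob = UNIV, Arr = {(A, f, B). f \<in> A \<rightarrow>\<^sub>E B},
      Dom = (\<lambda>(A, f, B). A), Cod = (\<lambda>(A, f, B). B),
      Idt = (\<lambda>A. (A, restrict (\<lambda>x. x) A, A)),
      Cmp = (\<lambda>(B', g, E) (A, f, B). (A, compose A g f, E))\<rparr>"

definition hom_functor ::
  "('o, 'a) cat \<Rightarrow> 'o \<Rightarrow> ('o, 'a, 'a set, 'a set \<times> ('a \<Rightarrow> 'a) \<times> 'a set) fctr" where
  "hom_functor C x =
     \<lparr>Fo = hom C x,
      Fa = (\<lambda>f. (hom C x (Dom C f), restrict (\<lambda>g. f \<cdot>\<^bsub>C\<^esub> g) (hom C x (Dom C f)),
        hom C x (Cod C f)))\<rparr>"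


section \<open>Chains\<close>

text \<open>Ordinals are rendered as well-orders in the sense of \<open>Well_order\<close>, and cardinals as
  well-orders satisfying \<open>Card_order\<close>.\<close>

definition poset_cat :: "'j rel \<Rightarrow> ('j, 'j \<times> 'j) cat" where
  "poset_cat r =
     \<lparr>Ob = Field r, Arr = r, Dom = fst, Cod = snd, Idt = (\<lambda>j. (j, j)),
      Cmp = (\<lambda>(j', k) (i, j). (i, k))\<rparr>"

definition cat_chain :: "'j rel \<Rightarrow> ('o, 'a) cat \<Rightarrow> ('j, 'j \<times> 'j, 'o, 'a) fctr \<Rightarrow> bool" where
  "cat_chain r C u \<longleftrightarrow> is_functor (poset_cat r) C u"

definition chain_bounded :: "'k rel \<Rightarrow> ('o, 'a) cat \<Rightarrow> bool" where
  "chain_bounded \<kappa> C \<longleftrightarrow>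
     (\<forall>(r :: 'k rel) u. Well_order r \<and> Field r \<noteq> {} \<and> r <o \<kappa> \<and> cat_chain r C u \<longrightarrow>
        (\<exists>x \<mu>. cocone (poset_cat r) C u x \<mu>))"

definition limit_elem :: "'k rel \<Rightarrow> 'k \<Rightarrow> bool" where
  "limit_elem \<kappa> j \<longleftrightarrow> j \<in> Field \<kappa> \<and> underS \<kappa> j \<noteq> {} \<and>
     (\<forall>i \<in> underS \<kappa> j. \<exists>k \<in> underS \<kappa> j. i \<in> underS \<kappa> k)"

definition continuous_chain ::
  "'k rel \<Rightarrow> ('o, 'a) cat \<Rightarrow> ('k, 'k \<times> 'k, 'o, 'a) fctr \<Rightarrow> bool" where
  "continuous_chain \<kappa> C u \<longleftrightarrow> cat_chain \<kappa> C u \<and>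
     (\<forall>j. limit_elem \<kappa> j \<longrightarrow>
        is_colimit (poset_cat (Restr \<kappa> (underS \<kappa> j))) C u (Fo u j) (\<lambda>i. Fa u (i, j)))"

definition chain_colim_subcat :: "'k rel \<Rightarrow> ('o, 'a) cat \<Rightarrow> ('p, 'b) cat \<Rightarrow>
    ('o, 'a, 'p, 'b) fctr \<Rightarrow> ('p, 'b) cat"  where
  "chain_colim_subcat \<kappa> C D i = full_subcat D
     (\<lambda>x. \<exists>u \<mu>. cat_chain \<kappa> C u \<and> is_colimit (poset_cat \<kappa>) D (comp_functor i u) x \<mu>)"

definition cont_chain_colim_subcat :: "'k rel \<Rightarrow> ('o, 'a) cat \<Rightarrow> ('p, 'b) cat \<Rightarrow>
    ('o, 'a, 'p, 'b) fctr \<Rightarrow> ('p, 'b) cat" where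
  "cont_chain_colim_subcat \<kappa> C D i = full_subcat D
     (\<lambda>x. \<exists>u \<mu>. continuous_chain \<kappa> C u \<and> is_colimit (poset_cat \<kappa>) D (comp_functor i u) x \<mu>)"

definition has_chain_colimits :: "'k rel \<Rightarrow> ('o, 'a) cat \<Rightarrow> ('p, 'b) cat \<Rightarrow>
    ('o, 'a, 'p, 'b) fctr \<Rightarrow> bool" where
  "has_chain_colimits \<kappa> C D i \<longleftrightarrow>
     (\<forall>u. cat_chain \<kappa> C u \<longrightarrow> (\<exists>x \<mu>. is_colimit (poset_cat \<kappa>) D (comp_functor i u) x \<mu>))"

definition small_object :: "'k rel \<Rightarrow> ('p, 'b) cat \<Rightarrow> 'p \<Rightarrow> bool" where
  "small_object \<kappa> D x \<longleftrightarrow>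
     (\<forall>d. cat_chain \<kappa> D d \<longrightarrow> preserves_colimit (poset_cat \<kappa>) D set_cat (hom_functor D x) d)"


section \<open>Amalgamation, dominating families, homogeneity\<close>

definition amalgamation :: "('o, 'a) cat \<Rightarrow> bool" where
  "amalgamation C \<longleftrightarrow>
     (\<forall>a \<in> Ob C. \<forall>b \<in> Ob C. \<forall>c \<in> Ob C. \<forall>f \<in> hom C a b. \<forall>g \<in> hom C a c.
        \<exists>d \<in> Ob C. \<exists>f' \<in> hom C b d. \<exists>g' \<in> hom C c d. f' \<cdot>\<^bsub>C\<^esub> f = g' \<cdot>\<^bsub>C\<^esub> g)"

definition joint_embedding :: "('o, 'a) cat \<Rightarrow> bool" where
  "joint_embedding C \<longleftrightarrow>
     (\<forall>a \<in> Ob C. \<forall>b \<in> Ob C. \<exists>c \<in> Ob C. hom C a c \<noteq> {} \<and> hom C b c \<noteq> {})"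

definition dominating :: "('o, 'a) cat \<Rightarrow> 'a set \<Rightarrow> bool" where
  "dominating C \<F> \<longleftrightarrow> \<F> \<subseteq> Arr C \<and>
     (\<forall>x \<in> Ob C. \<exists>a \<in> Dom C ` \<F>. hom C x a \<noteq> {}) \<and>
     (\<forall>a \<in> Dom C ` \<F>. \<forall>x \<in> Ob C. \<forall>f \<in> hom C a x.
        \<exists>g \<in> Arr C. Dom C g = x \<and> g \<cdot>\<^bsub>C\<^esub> f \<in> \<F>)"

definition homogeneous :: "('o, 'a) cat \<Rightarrow> ('p, 'b) cat \<Rightarrow> ('o, 'a, 'p, 'b) fctr \<Rightarrow> 'p \<Rightarrow> bool" where
  "homogeneous C D i u \<longleftrightarrow>
     (\<forall>a \<in> Ob C. \<forall>b \<in> Ob C. \<forall>j \<in> hom C a b. \<forall>\<chi> \<in> hom D (Fo i a) u.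
        \<exists>\<chi>' \<in> hom D (Fo i b) u. \<chi>' \<cdot>\<^bsub>D\<^esub> Fa i j = \<chi>)"

definition ultrahomogeneous ::
  "('o, 'a) cat \<Rightarrow> ('p, 'b) cat \<Rightarrow> ('o, 'a, 'p, 'b) fctr \<Rightarrow> 'p \<Rightarrow> bool" where
  "ultrahomogeneous C D i u \<longleftrightarrow>
     (\<forall>a \<in> Ob C. \<forall>b \<in> Ob C. \<forall>j \<in> hom C a b. \<forall>\<chi>1 \<in> hom D (Fo i a) u. \<forall>\<chi>2 \<in> hom D (Fo i b) u.
        \<exists>k \<in> hom D u u. is_iso D k \<and> k \<cdot>\<^bsub>D\<^esub> \<chi>1 = \<chi>2 \<cdot>\<^bsub>D\<^esub> Fa i j)"

definition universal :: "('o, 'a) cat \<Rightarrow> ('p, 'b) cat \<Rightarrow> ('o, 'a, 'p, 'b) fctr \<Rightarrow> 'p \<Rightarrow> bool" where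
  "universal C D i u \<longleftrightarrow> (\<forall>a \<in> Ob C. hom D (Fo i a) u \<noteq> {})"


section \<open>Well-formedness of the constructions\<close>

lemma hom_full_subcat [simp]:
  "hom (full_subcat C P) x y = {f \<in> hom C x y. P x \<and> P y}"
  by (auto simp: hom_def full_subcat_def)

lemma full_subcat_simps [simp]:
  "Ob (full_subcat C P) = {x \<in> Ob C. P x}"
  "Arr (full_subcat C P) = {f \<in> Arr C. P (Dom C f) \<and> P (Cod C f)}"
  "Dom (full_subcat C P) = Dom C" "Cod (full_subcat C P) = Cod C"
  "Idt (full_subcat C P) = Idt C" "Cmp (full_subcat C P) = Cmp C"
  by (simp_all add: full_subcat_def)

lemma category_full_subcat:
  assumes "category C"
  shows "category (full_subcat C P)"
proof -
  interpret category C by fact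
  show ?thesis
  proof
    fix x y z f g
    assume "f \<in> hom (full_subcat C P) x y" "g \<in> hom (full_subcat C P) y z"
    then show "g \<cdot>\<^bsub>full_subcat C P\<^esub> f \<in> hom (full_subcat C P) x z"
      using Cmp_hom[of f x y g z] by simp
  qed (auto simp: Dom_Ob Cod_Ob Idt_hom Cmp_Idt Idt_Cmp Cmp_assoc)
qed

lemma category_poset_cat:
  assumes "refl_on (Field r) r" "trans r"
  shows "category (poset_cat r)"
  using assms
  by unfold_locales
    (auto simp: poset_cat_def hom_def refl_on_def intro: FieldI1 FieldI2 dest: transD)

lemma hom_set_cat: "hom set_cat A B = {(A', f, B'). A' = A \<and> B' = B \<and> f \<in> A \<rightarrow>\<^sub>E B}"
  by (auto simp: hom_def set_cat_def)

lemma set_cat_simps: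
  "Ob set_cat = UNIV" "Idt set_cat A = (A, restrict (\<lambda>x. x) A, A)"
  "(B', g, E) \<cdot>\<^bsub>set_cat\<^esub> (A, f, B) = (A, compose A g f, E)"
  by (simp_all add: set_cat_def)

lemma category_set_cat: "category set_cat"
proof
  fix A B E :: "'x set" and f g
  assume "f \<in> hom set_cat A B" "g \<in> hom set_cat B E"
  then show "g \<cdot>\<^bsub>set_cat\<^esub> f \<in> hom set_cat A E"
    by (auto simp: hom_set_cat set_cat_simps compose_def PiE_iff)
next
  fix A B :: "'x set" and f
  assume "f \<in> hom set_cat A B"
  then show "f \<cdot>\<^bsub>set_cat\<^esub> Idt set_cat A = f" "Idt set_cat B \<cdot>\<^bsub>set_cat\<^esub> f = f"
    by (auto simp: hom_set_cat set_cat_simps PiE_def compose_Id Id_compose)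
next
  fix A B E G :: "'x set" and f g h
  assume "f \<in> hom set_cat A B" "g \<in> hom set_cat B E" "h \<in> hom set_cat E G"
  then show "(h \<cdot>\<^bsub>set_cat\<^esub> g) \<cdot>\<^bsub>set_cat\<^esub> f = h \<cdot>\<^bsub>set_cat\<^esub> (g \<cdot>\<^bsub>set_cat\<^esub> f)"
    by (auto simp: hom_set_cat set_cat_simps PiE_def compose_assoc[symmetric])
qed (auto simp: hom_set_cat set_cat_simps)

lemma is_functor_hom_functor:
  assumes "category C" "x \<in> Ob C"
  shows "is_functor C set_cat (hom_functor C x)"
proof -
  interpret category C by fact
  show ?thesis
    unfolding is_functor_def
  proof (intro conjI allI ballI)
    fix y z w f g assume f: "f \<in> hom C y z" and g: "g \<in> hom C z w"
    have gf: "g \<cdot>\<^bsub>C\<^esub> f \<in> hom C y w" using f g by (rule Cmp_hom)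
    have *: "f \<cdot>\<^bsub>C\<^esub> h \<in> hom C x z" "(g \<cdot>\<^bsub>C\<^esub> f) \<cdot>\<^bsub>C\<^esub> h = g \<cdot>\<^bsub>C\<^esub> (f \<cdot>\<^bsub>C\<^esub> h)" if "h \<in> hom C x y" for h
      using that f g by (auto intro: Cmp_hom Cmp_assoc)
    have "Dom C f = y" "Cod C f = z" "Dom C g = z" "Cod C g = w"
      "Dom C (g \<cdot>\<^bsub>C\<^esub> f) = y" "Cod C (g \<cdot>\<^bsub>C\<^esub> f) = w"
      using f g gf by (auto simp: hom_def)
    then show "Fa (hom_functor C x) (g \<cdot>\<^bsub>C\<^esub> f) =
        Fa (hom_functor C x) g \<cdot>\<^bsub>set_cat\<^esub> Fa (hom_functor C x) f"
      using * by (auto simp: hom_functor_def set_cat_def compose_def fun_eq_iff)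
  next
    fix y z f assume f: "f \<in> hom C y z"
    then have "Dom C f = y" "Cod C f = z" by (auto simp: hom_def)
    with f show "Fa (hom_functor C x) f \<in>
        hom set_cat (Fo (hom_functor C x) y) (Fo (hom_functor C x) z)"
      by (auto simp: hom_functor_def hom_set_cat intro: Cmp_hom)
  next
    fix y assume y: "y \<in> Ob C"
    then have "Dom C (Idt C y) = y" "Cod C (Idt C y) = y"
      using Idt_hom[OF y] by (auto simp: hom_def)
    then show "Fa (hom_functor C x) (Idt C y) = Idt set_cat (Fo (hom_functor C x) y)"
      by (auto simp: hom_functor_def set_cat_def Idt_Cmp fun_eq_iff)
  qed (auto simp: set_cat_def)
qed

lemma is_functor_comp_functor:
  assumes "is_functor C D F" "is_functor D E G"
  shows "is_functor C E (comp_functor G F)"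
proof -
  have "Fo F x \<in> Ob D" "Fa F (Idt C x) = Idt D (Fo F x)" if "x \<in> Ob C" for x
    using assms(1) that unfolding is_functor_def by blast+
  moreover have "Fo G x \<in> Ob E" "Fa G (Idt D x) = Idt E (Fo G x)" if "x \<in> Ob D" for x
    using assms(2) that unfolding is_functor_def by blast+
  moreover have F: "Fa F f \<in> hom D (Fo F x) (Fo F y)" if "f \<in> hom C x y" for f x y
    using assms(1) that unfolding is_functor_def by blast
  moreover have "Fa G f \<in> hom E (Fo G x) (Fo G y)" if "f \<in> hom D x y" for f x y
    using assms(2) that unfolding is_functor_def by blast
  moreover have "Fa G (Fa F (g \<cdot>\<^bsub>C\<^esub> f)) = Fa G (Fa F g) \<cdot>\<^bsub>E\<^esub> Fa G (Fa F f)"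
    if "f \<in> hom C x y" "g \<in> hom C y z" for f g x y z
  proof -
    have "Fa F (g \<cdot>\<^bsub>C\<^esub> f) = Fa F g \<cdot>\<^bsub>D\<^esub> Fa F f"
      using assms(1) that unfolding is_functor_def by blast
    moreover have "Fa G (Fa F g \<cdot>\<^bsub>D\<^esub> Fa F f) = Fa G (Fa F g) \<cdot>\<^bsub>E\<^esub> Fa G (Fa F f)"
      using assms(2) F[OF that(1)] F[OF that(2)] unfolding is_functor_def by blast
    ultimately show ?thesis by simp
  qed
  ultimately show ?thesis
    unfolding is_functor_def comp_functor_def by simp
qed

end

theory Submission
  imports Defs
begin

text \<open>
  The existence half is a Fraisse construction. Boundedness, amalgamation and the dominating family
  give a \<open>\<kappa>\<close>-chain \<open>u\<close> in \<open>C\<close> that absorbs arrows: each arrow \<open>f : u\<^sub>\<alpha> \<rightarrow> y\<close> of \<open>C\<close> can be followed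
  by some \<open>g : y \<rightarrow> u\<^sub>\<beta>\<close> so that the composite is the arrow \<open>u\<^sub>\<alpha> \<rightarrow> u\<^sub>\<beta>\<close> of the chain
  (\<open>exists_absorbing_chain\<close>). Let \<open>x\<close> be its colimit in \<open>D\<close>. By smallness an arrow from an
  object of \<open>C\<close> to \<open>x\<close> is already an arrow of \<open>C\<close> into some stage of the chain, and two such arrows
  into a stage that agree in \<open>x\<close> agree at a later stage. Extension problems for \<open>x\<close> therefore turn
  into problems in \<open>C\<close>: amalgamating and then absorbing shows that \<open>x\<close> is homogeneous, and joint
  embedding and then absorbing that it is universal. The converse reads the same translation
  backwards: homogeneity and universality provide arrows into the colimit \<open>x\<close> which solve an
  amalgamation or joint embedding problem there, and by smallness the solution already exists at
  a stage of the chain.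

  Ultrahomogeneity and uniqueness are both instances of one statement: if \<open>x\<close> and \<open>y\<close> are
  homogeneous colimits of continuous chains \<open>U\<close> and \<open>V\<close>, then any two arrows \<open>\<chi>\<^sub>1 : a \<rightarrow> x\<close> and
  \<open>\<chi>\<^sub>2 : a \<rightarrow> y\<close> from an object of \<open>C\<close> satisfy \<open>k \<circ> \<chi>\<^sub>1 = \<chi>\<^sub>2\<close> for an isomorphism \<open>k : x \<rightarrow> y\<close>
  (\<open>arrows_differ_by_iso\<close>). For ultrahomogeneity take \<open>y = x\<close> and replace \<open>\<chi>\<^sub>2\<close> by \<open>\<chi>\<^sub>2 \<circ> j\<close>; for
  uniqueness, universality of \<open>x\<close> and \<open>y\<close> supplies \<open>\<chi>\<^sub>1\<close> and \<open>\<chi>\<^sub>2\<close>. The isomorphism is the union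
  of an increasing family of arrows \<open>U\<^sub>\<alpha> \<rightarrow> y\<close>, prolonged so that every stage of \<open>V\<close> is eventually
  reached. Prolonging one of them uses homogeneity of both \<open>x\<close> and \<open>y\<close>
  (\<open>partial_map_prolong\<close>); bounding fewer than \<open>\<kappa>\<close> of them uses regularity of \<open>\<kappa>\<close>,
  continuity of \<open>U\<close> and monicity (\<open>partial_maps_upper_bound\<close>). The resulting \<open>k\<close> is monic and
  every colimit arrow \<open>V\<^sub>\<xi> \<rightarrow> y\<close> factors through it, so it is invertible.
\<close>


section \<open>Chains and cocones indexed by a well-order\<close>

lemma (in category) hom_Ob: "f \<in> hom C x y \<Longrightarrow> x \<in> Ob C" "f \<in> hom C x y \<Longrightarrow> y \<in> Ob C"
  using Dom_Ob Cod_Ob by (auto simp: hom_def)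

lemma hom_poset_cat: "hom (poset_cat r) i j = {e. e = (i, j) \<and> (i, j) \<in> r}"
  by (auto simp: hom_def poset_cat_def)

lemma poset_cat_simps:
  "Ob (poset_cat r) = Field r" "Arr (poset_cat r) = r" "Idt (poset_cat r) j = (j, j)"
  "Dom (poset_cat r) = fst" "Cod (poset_cat r) = snd" "(j', k) \<cdot>\<^bsub>poset_cat r\<^esub> (i, j) = (i, k)"
  by (simp_all add: poset_cat_def)

lemma Well_order_facts:
  assumes "Well_order r"
  shows "j \<in> Field r \<Longrightarrow> (j, j) \<in> r" "(i, j) \<in> r \<Longrightarrow> (j, k) \<in> r \<Longrightarrow> (i, k) \<in> r"
    "(i, j) \<in> r \<Longrightarrow> (j, i) \<in> r \<Longrightarrow> i = j"
    "i \<in> Field r \<Longrightarrow> j \<in> Field r \<Longrightarrow> (i, j) \<in> r \<or> (j, i) \<in> r" "wf (r - Id)"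
proof -
  interpret wo_rel r using assms by (simp add: wo_rel_def)
  show "j \<in> Field r \<Longrightarrow> (j, j) \<in> r" using REFL by (auto simp: refl_on_def)
  show "(i, j) \<in> r \<Longrightarrow> (j, k) \<in> r \<Longrightarrow> (i, k) \<in> r" using TRANS by (auto dest: transD)
  show "(i, j) \<in> r \<Longrightarrow> (j, i) \<in> r \<Longrightarrow> i = j" using ANTISYM by (auto dest: antisymD)
  show "i \<in> Field r \<Longrightarrow> j \<in> Field r \<Longrightarrow> (i, j) \<in> r \<or> (j, i) \<in> r" using TOTALS by blast
  show "wf (r - Id)" by (rule WF)
qed

lemma underS_downward_closed:
  assumes "Well_order r" "(i, j) \<in> r" "j \<in> underS r k"
  shows "i \<in> underS r k"
proof -
  have jk: "(j, k) \<in> r" "j \<noteq> k" using assms(3) by (auto simp: underS_def)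
  then have "i \<noteq> k" using Well_order_facts(3)[OF assms(1,2)] by blast
  then show ?thesis
    using Well_order_facts(2)[OF assms(1,2) jk(1)] by (simp add: underS_def)
qed

lemma category_poset_cat_Well_order: "Well_order r \<Longrightarrow> category (poset_cat r)"
  by (rule category_poset_cat)
    (auto simp: well_order_on_def linear_order_on_def partial_order_on_def preorder_on_def)

lemma Field_Restr_underS:
  assumes "Well_order r" shows "Field (Restr r (underS r j)) = underS r j"
proof -
  have "(i, i) \<in> r" if "i \<in> underS r j" for i
    using that Well_order_facts(1)[OF assms] by (auto simp: underS_def Field_def)
  then show ?thesis by (auto simp: Field_def)
qed

lemma cat_chainD:
  assumes "cat_chain r C u"
  shows "j \<in> Field r \<Longrightarrow> Fo u j \<in> Ob C"
    "(i, j) \<in> r \<Longrightarrow> Fa u (i, j) \<in> hom C (Fo u i) (Fo u j)"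
    "j \<in> Field r \<Longrightarrow> Fa u (j, j) = Idt C (Fo u j)"
    "(i, j) \<in> r \<Longrightarrow> (j, k) \<in> r \<Longrightarrow> Fa u (j, k) \<cdot>\<^bsub>C\<^esub> Fa u (i, j) = Fa u (i, k)"
  using assms unfolding cat_chain_def is_functor_def
  by (auto simp: hom_poset_cat poset_cat_simps)

lemma cat_chainI:
  assumes "\<And>j. j \<in> Field r \<Longrightarrow> Fo u j \<in> Ob C"
    "\<And>i j. (i, j) \<in> r \<Longrightarrow> Fa u (i, j) \<in> hom C (Fo u i) (Fo u j)"
    "\<And>j. j \<in> Field r \<Longrightarrow> Fa u (j, j) = Idt C (Fo u j)"
    "\<And>i j k. (i, j) \<in> r \<Longrightarrow> (j, k) \<in> r \<Longrightarrow> Fa u (j, k) \<cdot>\<^bsub>C\<^esub> Fa u (i, j) = Fa u (i, k)"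
  shows "cat_chain r C u"
  using assms unfolding cat_chain_def is_functor_def
  by (auto simp: hom_poset_cat poset_cat_simps)

lemma cocone_poset_cat_iff:
  "cocone (poset_cat r) C u x \<mu> \<longleftrightarrow> x \<in> Ob C \<and> (\<forall>j \<in> Field r. \<mu> j \<in> hom C (Fo u j) x) \<and>
     (\<forall>i j. (i, j) \<in> r \<longrightarrow> \<mu> j \<cdot>\<^bsub>C\<^esub> Fa u (i, j) = \<mu> i)"
  by (auto simp: cocone_def poset_cat_def)

lemma colimit_arrow_eqI:
  assumes "category J" "category C" "is_functor J C F" "is_colimit J C F x \<mu>"
    and h: "h \<in> hom C x y" and h': "h' \<in> hom C x y"
    and eq: "\<And>j. j \<in> Ob J \<Longrightarrow> h \<cdot>\<^bsub>C\<^esub> \<mu> j = h' \<cdot>\<^bsub>C\<^esub> \<mu> j"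
  shows "h = h'"
proof -
  interpret J: category J by fact
  interpret C: category C by fact
  have cc: "cocone J C F x \<mu>" using assms(4) by (simp add: is_colimit_def)
  have "cocone J C F y (\<lambda>j. h \<cdot>\<^bsub>C\<^esub> \<mu> j)"
    unfolding cocone_def
  proof (intro conjI ballI)
    show "y \<in> Ob C" using C.hom_Ob h by blast
    show "h \<cdot>\<^bsub>C\<^esub> \<mu> j \<in> hom C (Fo F j) y" if "j \<in> Ob J" for j
      using C.Cmp_hom h cc that unfolding cocone_def by blast
    fix e assume e: "e \<in> Arr J"
    then have "Fa F e \<in> hom C (Fo F (Dom J e)) (Fo F (Cod J e))"
      using assms(3) unfolding is_functor_def hom_def by blast
    moreover have "\<mu> (Cod J e) \<in> hom C (Fo F (Cod J e)) x"
      using cc J.Cod_Ob[OF e] unfolding cocone_def by blast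
    moreover have "\<mu> (Cod J e) \<cdot>\<^bsub>C\<^esub> Fa F e = \<mu> (Dom J e)"
      using cc e unfolding cocone_def by blast
    ultimately show "(h \<cdot>\<^bsub>C\<^esub> \<mu> (Cod J e)) \<cdot>\<^bsub>C\<^esub> Fa F e = h \<cdot>\<^bsub>C\<^esub> \<mu> (Dom J e)"
      using C.Cmp_assoc h by metis
  qed
  then have "\<exists>!k. k \<in> hom C x y \<and> (\<forall>j \<in> Ob J. k \<cdot>\<^bsub>C\<^esub> \<mu> j = h \<cdot>\<^bsub>C\<^esub> \<mu> j)"
    using assms(4) unfolding is_colimit_def by blast
  then show ?thesis using h h' eq by metis
qed


section \<open>What smallness means for arrows\<close>

text \<open>A colimit of a chain in the category of sets is the union of the images of its stages, and two
  elements of a stage become equal in the colimit only if they become equal at some later stage.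
  Both facts follow by testing against maps into a set with two elements \<open>p \<noteq> q\<close>. In
  \<open>set_cat\<close> such a set exists as soon as the type of arrows has two elements; otherwise the
  category has a single arrow and a single object, and the two claims are immediate.\<close>

context
  fixes \<kappa> :: "'k rel" and D :: "('p, 'b) cat" and d :: "('k, 'k \<times> 'k, 'p, 'b) fctr"
    and a x :: 'p and \<mu> :: "'k \<Rightarrow> 'b"
  assumes \<kappa>: "Well_order \<kappa>" and D: "category D" and a: "a \<in> Ob D"
    and small: "small_object \<kappa> D a"
    and chain: "cat_chain \<kappa> D d" and colim: "is_colimit (poset_cat \<kappa>) D d x \<mu>"
begin

interpretation D: category D by (rule D)

private lemma \<mu>: "j \<in> Field \<kappa> \<Longrightarrow> \<mu> j \<in> hom D (Fo d j) x"
  using colim unfolding is_colimit_def cocone_poset_cat_iff by blast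

private lemma hom_functor_\<mu>:
  "j \<in> Field \<kappa> \<Longrightarrow> (Fa (hom_functor D a) \<circ> \<mu>) j =
     (hom D a (Fo d j), restrict (\<lambda>g. \<mu> j \<cdot>\<^bsub>D\<^esub> g) (hom D a (Fo d j)), hom D a x)"
  using \<mu>[of j] by (auto simp: hom_functor_def hom_def)

private lemma set_colimit:
  "is_colimit (poset_cat \<kappa>) set_cat (comp_functor (hom_functor D a) d) (hom D a x)
     (Fa (hom_functor D a) \<circ> \<mu>)"
  using small chain colim unfolding small_object_def preserves_colimit_def
  by (fastforce simp: hom_functor_def)

private lemma set_functor:
  "is_functor (poset_cat \<kappa>) set_cat (comp_functor (hom_functor D a) d)"
  using is_functor_comp_functor[OF _ is_functor_hom_functor[OF D a]] chain
  by (simp add: cat_chain_def)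

lemma small_object_factor:
  assumes h: "h \<in> hom D a x"
  shows "\<exists>j \<in> Field \<kappa>. \<exists>h' \<in> hom D a (Fo d j). \<mu> j \<cdot>\<^bsub>D\<^esub> h' = h"
proof (cases "\<exists>p q :: 'b. p \<noteq> q")
  case True
  then obtain p q :: 'b where pq: "p \<noteq> q" by blast
  define Q where "Q g \<longleftrightarrow> (\<exists>j \<in> Field \<kappa>. \<exists>h' \<in> hom D a (Fo d j). \<mu> j \<cdot>\<^bsub>D\<^esub> h' = g)" for g
  let ?h1 = "(hom D a x, restrict (\<lambda>_. p) (hom D a x), UNIV :: 'b set)"
  let ?h2 = "(hom D a x, restrict (\<lambda>g. if Q g then p else q) (hom D a x), UNIV :: 'b set)"
  have "?h1 = ?h2"
  proof (rule colimit_arrow_eqI[OF category_poset_cat_Well_order[OF \<kappa>] category_set_cat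
        set_functor set_colimit])
    show "?h1 \<in> hom set_cat (hom D a x) UNIV" "?h2 \<in> hom set_cat (hom D a x) UNIV"
      by (auto simp: hom_set_cat)
    fix j assume "j \<in> Ob (poset_cat \<kappa>)"
    then have j: "j \<in> Field \<kappa>" by (simp add: poset_cat_def)
    have "\<mu> j \<cdot>\<^bsub>D\<^esub> g \<in> hom D a x" "Q (\<mu> j \<cdot>\<^bsub>D\<^esub> g)" if "g \<in> hom D a (Fo d j)" for g
      using D.Cmp_hom[OF that \<mu>[OF j]] that j by (auto simp: Q_def)
    then show "?h1 \<cdot>\<^bsub>set_cat\<^esub> (Fa (hom_functor D a) \<circ> \<mu>) j = ?h2 \<cdot>\<^bsub>set_cat\<^esub> (Fa (hom_functor D a) \<circ> \<mu>) j"
      unfolding hom_functor_\<mu>[OF j] set_cat_simps by (auto simp: compose_def fun_eq_iff)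
  qed
  then have "restrict (\<lambda>_. p) (hom D a x) h =
      restrict (\<lambda>g. if Q g then p else q) (hom D a x) h" by simp
  then have "Q h" using h pq by (auto split: if_splits)
  then show ?thesis by (simp add: Q_def)
next
  case False
  then have one: "f = g" for f g :: 'b by blast
  have F: "Field \<kappa> \<noteq> {}"
  proof
    assume "Field \<kappa> = {}"
    then have cc: "cocone (poset_cat \<kappa>) set_cat (comp_functor (hom_functor D a) d) {}
        (Fa (hom_functor D a) \<circ> \<mu>)"
      by (auto simp: cocone_poset_cat_iff set_cat_def Field_def)
    then obtain m where "m \<in> hom set_cat (hom D a x) {}"
      using set_colimit unfolding is_colimit_def by blast
    then show False using h by (auto simp: hom_set_cat)
  qed
  then obtain j where j: "j \<in> Field \<kappa>" by blast
  have "Idt D a \<in> hom D a (Fo d j)"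
    using D.Idt_hom[OF a] D.Idt_hom[OF cat_chainD(1)[OF chain j]]
      one[of "Idt D a" "Idt D (Fo d j)"] by (auto simp: hom_def)
  then show ?thesis using j one by blast
qed

lemma small_object_equalize:
  assumes j: "j \<in> Field \<kappa>" and f: "f \<in> hom D a (Fo d j)" and g: "g \<in> hom D a (Fo d j)"
    and eq: "\<mu> j \<cdot>\<^bsub>D\<^esub> f = \<mu> j \<cdot>\<^bsub>D\<^esub> g"
  shows "\<exists>k. (j, k) \<in> \<kappa> \<and> Fa d (j, k) \<cdot>\<^bsub>D\<^esub> f = Fa d (j, k) \<cdot>\<^bsub>D\<^esub> g"
proof (cases "\<exists>p q :: 'b. p \<noteq> q")
  case True
  then obtain p q :: 'b where pq: "p \<noteq> q" by blast
  note w = Well_order_facts[OF \<kappa>]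
  define Q where "Q k t \<longleftrightarrow> (\<exists>l. (k, l) \<in> \<kappa> \<and> (j, l) \<in> \<kappa> \<and> Fa d (k, l) \<cdot>\<^bsub>D\<^esub> t = Fa d (j, l) \<cdot>\<^bsub>D\<^esub> f)"
    for k t
  define \<nu> where "\<nu> k = (hom D a (Fo d k),
      restrict (\<lambda>t. if Q k t then p else q) (hom D a (Fo d k)), UNIV :: 'b set)" for k
  have Q: "Q m (Fa d (k, m) \<cdot>\<^bsub>D\<^esub> t) = Q k t" if km: "(k, m) \<in> \<kappa>" and t: "t \<in> hom D a (Fo d k)" for k m t
  proof
    assume "Q m (Fa d (k, m) \<cdot>\<^bsub>D\<^esub> t)"
    then obtain l where l: "(m, l) \<in> \<kappa>" "(j, l) \<in> \<kappa>"
      and e: "Fa d (m, l) \<cdot>\<^bsub>D\<^esub> (Fa d (k, m) \<cdot>\<^bsub>D\<^esub> t) = Fa d (j, l) \<cdot>\<^bsub>D\<^esub> f" by (auto simp: Q_def)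
    have "Fa d (k, l) \<cdot>\<^bsub>D\<^esub> t = Fa d (j, l) \<cdot>\<^bsub>D\<^esub> f"
      using e D.Cmp_assoc[OF t cat_chainD(2)[OF chain km] cat_chainD(2)[OF chain l(1)]]
        cat_chainD(4)[OF chain km l(1)] by simp
    then show "Q k t" unfolding Q_def using w(2)[OF km l(1)] l(2) by blast
  next
    assume "Q k t"
    then obtain l where l: "(k, l) \<in> \<kappa>" "(j, l) \<in> \<kappa>"
      and e: "Fa d (k, l) \<cdot>\<^bsub>D\<^esub> t = Fa d (j, l) \<cdot>\<^bsub>D\<^esub> f" by (auto simp: Q_def)
    obtain n where n: "(l, n) \<in> \<kappa>" "(m, n) \<in> \<kappa>"
      using w(4)[of l m] w(1)[of l] w(1)[of m] km l by (meson FieldI2)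
    have "Fa d (m, n) \<cdot>\<^bsub>D\<^esub> (Fa d (k, m) \<cdot>\<^bsub>D\<^esub> t) = Fa d (k, n) \<cdot>\<^bsub>D\<^esub> t"
      using D.Cmp_assoc[OF t cat_chainD(2)[OF chain km] cat_chainD(2)[OF chain n(2)]]
        cat_chainD(4)[OF chain km n(2)] by simp
    also have "\<dots> = Fa d (l, n) \<cdot>\<^bsub>D\<^esub> (Fa d (k, l) \<cdot>\<^bsub>D\<^esub> t)"
      using D.Cmp_assoc[OF t cat_chainD(2)[OF chain l(1)] cat_chainD(2)[OF chain n(1)]]
        cat_chainD(4)[OF chain l(1) n(1)] by simp
    also have "\<dots> = Fa d (j, n) \<cdot>\<^bsub>D\<^esub> f"
      using D.Cmp_assoc[OF f cat_chainD(2)[OF chain l(2)] cat_chainD(2)[OF chain n(1)]]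
        cat_chainD(4)[OF chain l(2) n(1)] e by simp
    finally show "Q m (Fa d (k, m) \<cdot>\<^bsub>D\<^esub> t)"
      unfolding Q_def using n(2) w(2)[OF l(2) n(1)] by blast
  qed
  have "cocone (poset_cat \<kappa>) set_cat (comp_functor (hom_functor D a) d) UNIV \<nu>"
    unfolding cocone_poset_cat_iff
  proof (intro conjI allI ballI impI)
    show "UNIV \<in> Ob set_cat" by (simp add: set_cat_def)
    show "\<nu> k \<in> hom set_cat (Fo (comp_functor (hom_functor D a) d) k) UNIV" for k
      by (auto simp: \<nu>_def hom_set_cat comp_functor_def hom_functor_def)
    fix k m assume km: "(k, m) \<in> \<kappa>"
    have dkm: "Fa d (k, m) \<in> hom D (Fo d k) (Fo d m)" by (rule cat_chainD(2)[OF chain km])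
    then have 1: "Fa (comp_functor (hom_functor D a) d) (k, m) =
        (hom D a (Fo d k), restrict (\<lambda>t. Fa d (k, m) \<cdot>\<^bsub>D\<^esub> t) (hom D a (Fo d k)), hom D a (Fo d m))"
      by (auto simp: comp_functor_def hom_functor_def hom_def)
    show "\<nu> m \<cdot>\<^bsub>set_cat\<^esub> Fa (comp_functor (hom_functor D a) d) (k, m) = \<nu> k"
      unfolding 1 \<nu>_def set_cat_simps
      using Q[OF km] D.Cmp_hom[OF _ dkm] by (auto simp: compose_def fun_eq_iff)
  qed
  then obtain m where m: "m \<in> hom set_cat (hom D a x) UNIV"
    and m\<nu>: "\<forall>k \<in> Field \<kappa>. m \<cdot>\<^bsub>set_cat\<^esub> (Fa (hom_functor D a) \<circ> \<mu>) k = \<nu> k"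
    using set_colimit unfolding is_colimit_def poset_cat_simps by blast
  obtain t where t: "m = (hom D a x, t, UNIV)" using m by (auto simp: hom_set_cat)
  have "m \<cdot>\<^bsub>set_cat\<^esub> (Fa (hom_functor D a) \<circ> \<mu>) j = \<nu> j" using m\<nu> j by blast
  then have "compose (hom D a (Fo d j)) t (restrict (\<lambda>g. \<mu> j \<cdot>\<^bsub>D\<^esub> g) (hom D a (Fo d j))) =
      restrict (\<lambda>t. if Q j t then p else q) (hom D a (Fo d j))"
    unfolding hom_functor_\<mu>[OF j] t set_cat_simps \<nu>_def by simp
  then have *: "t (\<mu> j \<cdot>\<^bsub>D\<^esub> s) = (if Q j s then p else q)" if "s \<in> hom D a (Fo d j)" for s
    using that by (auto simp: compose_def fun_eq_iff split: if_splits)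
  have "Q j f" unfolding Q_def using w(1)[OF j] by blast
  then have "Q j g" using *[OF f] *[OF g] eq pq by (auto split: if_splits)
  then show ?thesis unfolding Q_def by metis
next
  case False
  then show ?thesis using Well_order_facts(1)[OF \<kappa> j] by blast
qed

end

section \<open>Cardinal bookkeeping\<close>

lemma regularCard_bounded:
  assumes \<kappa>: "Cinfinite \<kappa>" "regularCard \<kappa>" and K: "K \<subseteq> Field \<kappa>" "|K| <o \<kappa>"
  shows "\<exists>\<beta> \<in> Field \<kappa>. \<forall>k \<in> K. (k, \<beta>) \<in> \<kappa>"
proof -
  have w: "Well_order \<kappa>" using \<kappa> by (auto simp: card_order_on_def)
  have "\<not> cofinal K \<kappa>" using \<kappa> K not_ordLess_ordIso unfolding regularCard_def by blast
  then obtain \<beta> where "\<beta> \<in> Field \<kappa>" "\<forall>k \<in> K. \<beta> = k \<or> (\<beta>, k) \<notin> \<kappa>"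
    unfolding cofinal_def by blast
  then show ?thesis using Well_order_facts(1,4)[OF w] K by (metis subsetD)
qed

text \<open>The tasks \<open>T\<close> are served along \<open>\<kappa>\<close> so that each of them comes up again and again: as
  \<open>|T \<times> \<kappa>| \<le> \<kappa>\<close>, every task can be given \<open>\<kappa>\<close> many slots of its own, and a set of size \<open>\<kappa>\<close> is
  contained in no proper initial segment.\<close>

lemma Cinfinite_recurrent_enumeration:
  fixes \<kappa> :: "'k rel" and T :: "'t set"
  assumes \<kappa>: "Cinfinite \<kappa>" and T: "|T| \<le>o \<kappa>"
  shows "\<exists>\<tau>. \<forall>t \<in> T. \<forall>\<alpha> \<in> Field \<kappa>. \<exists>\<xi>. \<alpha> \<in> underS \<kappa> \<xi> \<and> \<tau> \<xi> = t"
proof -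
  have co: "Card_order \<kappa>" and inf: "\<not> finite (Field \<kappa>)" using \<kappa> by (auto simp: cinfinite_def)
  have w: "Well_order \<kappa>" using co by (simp add: card_order_on_def)
  note wf = Well_order_facts[OF w]
  have F: "|Field \<kappa>| =o \<kappa>" using co by (rule card_of_Field_ordIso)
  have "|T \<times> Field \<kappa>| \<le>o \<kappa>"
    using card_of_Times_ordLeq_infinite_Field[OF inf T _ co] F ordIso_iff_ordLeq by blast
  then have "|T \<times> Field \<kappa>| \<le>o |Field \<kappa>|"
    using F ordIso_symmetric ordLeq_ordIso_trans by blast
  then obtain g where g: "inj_on g (T \<times> Field \<kappa>)" "g ` (T \<times> Field \<kappa>) \<subseteq> Field \<kappa>"
    unfolding card_of_ordLeq[symmetric] by blast
  define \<tau> where "\<tau> \<xi> = fst (inv_into (T \<times> Field \<kappa>) g \<xi>)" for \<xi>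
  have "\<exists>\<xi>. \<alpha> \<in> underS \<kappa> \<xi> \<and> \<tau> \<xi> = t" if t: "t \<in> T" and \<alpha>: "\<alpha> \<in> Field \<kappa>" for t \<alpha>
  proof (rule ccontr)
    assume no: "\<not> ?thesis"
    obtain \<beta> where \<beta>: "\<beta> \<in> Field \<kappa>" "\<alpha> \<noteq> \<beta>" "(\<alpha>, \<beta>) \<in> \<kappa>" using Cinfinite_limit[OF \<alpha> \<kappa>] by blast
    have "g (t, \<gamma>) \<in> underS \<kappa> \<beta>" if \<gamma>: "\<gamma> \<in> Field \<kappa>" for \<gamma>
    proof -
      have "\<tau> (g (t, \<gamma>)) = t" using g(1) t \<gamma> by (simp add: \<tau>_def)
      then have "\<alpha> \<notin> underS \<kappa> (g (t, \<gamma>))" using no by blast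
      moreover have "g (t, \<gamma>) \<in> Field \<kappa>" using g(2) t \<gamma> by blast
      ultimately have "(g (t, \<gamma>), \<alpha>) \<in> \<kappa>" using wf(1,4) \<alpha> by (auto simp: underS_def)
      moreover have "\<alpha> \<in> underS \<kappa> \<beta>" using \<beta> by (simp add: underS_def)
      ultimately show ?thesis using underS_downward_closed[OF w] by blast
    qed
    moreover have "inj_on (\<lambda>\<gamma>. g (t, \<gamma>)) (Field \<kappa>)"
      using g(1) t by (auto simp: inj_on_def)
    ultimately have "|Field \<kappa>| \<le>o |underS \<kappa> \<beta>|"
      using card_of_ordLeq[of "Field \<kappa>" "underS \<kappa> \<beta>"] by blast
    then have "|Field \<kappa>| <o \<kappa>" using card_of_underS[OF co \<beta>(1)] by (rule ordLeq_ordLess_trans)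
    then show False using F not_ordLess_ordIso by blast
  qed
  then show ?thesis by blast
qed


section \<open>A chain that absorbs all arrows out of its stages\<close>

text \<open>Together with cofinality, which the joint embedding property then provides, this is what
  Kubis calls a Fraisse sequence.\<close>

definition absorbing_chain :: "'k rel \<Rightarrow> ('o, 'a) cat \<Rightarrow> ('k, 'k \<times> 'k, 'o, 'a) fctr \<Rightarrow> bool" where
  "absorbing_chain \<kappa> C u \<longleftrightarrow> cat_chain \<kappa> C u \<and>
     (\<forall>\<alpha> \<in> Field \<kappa>. \<forall>y. \<forall>f \<in> hom C (Fo u \<alpha>) y.
        \<exists>\<beta> g. (\<alpha>, \<beta>) \<in> \<kappa> \<and> g \<in> hom C y (Fo u \<beta>) \<and> g \<cdot>\<^bsub>C\<^esub> f = Fa u (\<alpha>, \<beta>))"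

text \<open>The stages are chosen by transfinite recursion inside the domain of the dominating
  family \<open>F\<close>, one task \<open>(\<alpha>, f) \<in> \<kappa> \<times> F\<close> at a time. At stage \<open>\<xi>\<close> a cocone over the
  earlier stages exists by boundedness, and if the task of \<open>\<xi>\<close> asks to absorb an arrow \<open>f \<in> F\<close>
  out of \<open>u\<^sub>\<alpha>\<close> with \<open>\<alpha> < \<xi>\<close>, the apex is amalgamated with the codomain of \<open>f\<close> along \<open>u\<^sub>\<alpha>\<close>.
  Since only arrows of \<open>F\<close> have to be treated, \<open>\<kappa>\<close> steps suffice, however large the hom-sets of
  the category are: an arbitrary arrow out of \<open>u\<^sub>\<alpha>\<close> can be prolonged to one in \<open>F\<close>.\<close>

theorem exists_absorbing_chain:
  fixes \<kappa> :: "'k rel" and C :: "('o, 'a) cat"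
  assumes \<kappa>: "Cinfinite \<kappa>" and C: "category C" and ne: "Ob C \<noteq> {}"
    and bd: "chain_bounded \<kappa> C" and am: "amalgamation C"
    and dom: "dominating C F" and F: "|F| \<le>o \<kappa>"
  shows "\<exists>u. absorbing_chain \<kappa> C u"
proof -
  interpret C: category C by fact
  have co: "Card_order \<kappa>" and inf: "\<not> finite (Field \<kappa>)" using \<kappa> by (auto simp: cinfinite_def)
  have w: "Well_order \<kappa>" using co by (simp add: card_order_on_def)
  note wo = Well_order_facts[OF w]
  have "|Field \<kappa> \<times> F| \<le>o \<kappa>"
    using card_of_Times_ordLeq_infinite_Field[OF inf _ F co] card_of_Field_ordIso[OF co]
      ordIso_iff_ordLeq by blast
  then obtain \<tau> :: "'k \<Rightarrow> 'k \<times> 'a"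
    where \<tau>: "\<forall>t \<in> Field \<kappa> \<times> F. \<forall>\<alpha> \<in> Field \<kappa>. \<exists>\<xi>. \<alpha> \<in> underS \<kappa> \<xi> \<and> \<tau> \<xi> = t"
    using Cinfinite_recurrent_enumeration[OF \<kappa>] by blast
  \<comment> \<open>A value \<open>r\<close> of the recursion at \<open>\<xi>\<close> consists of the object \<open>u\<^sub>\<xi>\<close> and the arrows
    \<open>u\<^sub>i \<rightarrow> u\<^sub>\<xi>\<close> for \<open>i \<le> \<xi>\<close>.\<close>
  define P where "P s \<xi> r \<longleftrightarrow> (\<xi> \<in> Field \<kappa> \<longrightarrow>
      fst r \<in> Dom C ` F \<and> snd r \<xi> = Idt C (fst r) \<and>
      (\<forall>i \<in> underS \<kappa> \<xi>. snd r i \<in> hom C (fst (s i)) (fst r)) \<and>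
      (\<forall>j \<in> underS \<kappa> \<xi>. \<forall>i. (i, j) \<in> \<kappa> \<longrightarrow> snd r j \<cdot>\<^bsub>C\<^esub> snd (s j) i = snd r i) \<and>
      (\<forall>\<alpha> \<in> underS \<kappa> \<xi>. \<forall>f \<in> F. \<tau> \<xi> = (\<alpha>, f) \<and> Dom C f = fst (s \<alpha>) \<longrightarrow>
         (\<exists>g \<in> hom C (Cod C f) (fst r). g \<cdot>\<^bsub>C\<^esub> f = snd r \<alpha>)))"
    for s :: "'k \<Rightarrow> 'o \<times> ('k \<Rightarrow> 'a)" and \<xi> r
  have DF: "x \<in> Ob C" if "x \<in> Dom C ` F" for x
    using that dom C.Dom_Ob unfolding dominating_def by blast
  have P_Ob: "fst (s j) \<in> Ob C" if "P s j (s j)" "j \<in> Field \<kappa>" for s j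
    using that DF unfolding P_def by blast
  have P_Idt: "snd (s j) j = Idt C (fst (s j))" if "P s j (s j)" "j \<in> Field \<kappa>" for s j
    using that unfolding P_def by blast
  have P_hom: "snd (s j) i \<in> hom C (fst (s i)) (fst (s j))"
    if "P s j (s j)" "(i, j) \<in> \<kappa>" for s i j
  proof (cases "i = j")
    case True
    then show ?thesis using P_Idt P_Ob C.Idt_hom that by (metis FieldI2)
  next
    case False
    then show ?thesis using that FieldI2[of i j \<kappa>] unfolding P_def underS_def by blast
  qed
  have P_Cmp: "snd (s k) j \<cdot>\<^bsub>C\<^esub> snd (s j) i = snd (s k) i"
    if "P s j (s j)" "P s k (s k)" "(i, j) \<in> \<kappa>" "(j, k) \<in> \<kappa>" for s i j k
  proof (cases "j = k")
    case True
    then show ?thesis using P_Idt P_hom C.Idt_Cmp that by (metis FieldI2)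
  next
    case False
    then show ?thesis using that FieldI2[of j k \<kappa>] unfolding P_def underS_def by blast
  qed
  let ?u = "\<lambda>s. \<lparr>Fo = \<lambda>j. fst (s j), Fa = \<lambda>(i, j). snd (s j) i\<rparr>"
  have "\<exists>s. \<forall>\<xi>. P s \<xi> (s \<xi>)"
  proof (rule dependent_wf_choice[OF wo(5)])
    fix s s' :: "'k \<Rightarrow> 'o \<times> ('k \<Rightarrow> 'a)" and \<xi> r
    assume eq: "\<And>z. (z, \<xi>) \<in> \<kappa> - Id \<Longrightarrow> s z = s' z"
    have "P f \<xi> r" if P: "P g \<xi> r" and fg: "\<forall>z \<in> underS \<kappa> \<xi>. f z = g z" for f g
      using P fg unfolding P_def by fastforce
    moreover have "\<forall>z \<in> underS \<kappa> \<xi>. s z = s' z" using eq by (auto simp: underS_def)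
    ultimately show "P s \<xi> r = P s' \<xi> r" by metis
  next
    fix \<xi> s assume "\<And>\<eta>. (\<eta>, \<xi>) \<in> \<kappa> - Id \<Longrightarrow> P s \<eta> (s \<eta>)"
    then have IH: "P s \<eta> (s \<eta>)" if "\<eta> \<in> underS \<kappa> \<xi>" for \<eta> using that by (auto simp: underS_def)
    show "\<exists>r. P s \<xi> r"
    proof (cases "\<xi> \<in> Field \<kappa>")
      case True
      have uF: "\<eta> \<in> Field \<kappa>" if "\<eta> \<in> underS \<kappa> \<xi>" for \<eta> using that underS_Field by fastforce
      have "\<exists>z m. z \<in> Ob C \<and> (\<forall>i \<in> underS \<kappa> \<xi>. m i \<in> hom C (fst (s i)) z) \<and>
          (\<forall>j \<in> underS \<kappa> \<xi>. \<forall>i. (i, j) \<in> \<kappa> \<longrightarrow> m j \<cdot>\<^bsub>C\<^esub> snd (s j) i = m i)"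
      proof (cases "underS \<kappa> \<xi> = {}")
        case False
        let ?r = "Restr \<kappa> (underS \<kappa> \<xi>)"
        have Fr: "Field ?r = underS \<kappa> \<xi>" by (rule Field_Restr_underS[OF w])
        have "cat_chain ?r C (?u s)"
          by (rule cat_chainI) (use P_Ob P_hom P_Idt P_Cmp IH uF in \<open>auto simp: Fr\<close>)
        moreover have "Well_order ?r" using w by (rule Well_order_Restr)
        moreover have "?r <o \<kappa>" using underS_Restr_ordLess[OF w] True by blast
        ultimately obtain z m where "cocone (poset_cat ?r) C (?u s) z m"
          using bd False Fr unfolding chain_bounded_def by metis
        then have z: "z \<in> Ob C" "\<forall>i \<in> underS \<kappa> \<xi>. m i \<in> hom C (fst (s i)) z"
          and m: "\<And>i j. (i, j) \<in> ?r \<Longrightarrow> m j \<cdot>\<^bsub>C\<^esub> snd (s j) i = m i"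
          by (auto simp: cocone_poset_cat_iff Fr)
        have "(i, j) \<in> ?r" if "j \<in> underS \<kappa> \<xi>" "(i, j) \<in> \<kappa>" for i j
          using that underS_downward_closed[OF w that(2,1)] by blast
        then show ?thesis using z m by blast
      qed (use ne in blast)
      then obtain z m where z: "z \<in> Ob C" and m: "\<And>i. i \<in> underS \<kappa> \<xi> \<Longrightarrow> m i \<in> hom C (fst (s i)) z"
        and mm: "\<And>i j. j \<in> underS \<kappa> \<xi> \<Longrightarrow> (i, j) \<in> \<kappa> \<Longrightarrow> m j \<cdot>\<^bsub>C\<^esub> snd (s j) i = m i"
        by blast
      have "\<exists>y h. h \<in> hom C z y \<and> (\<forall>\<alpha> \<in> underS \<kappa> \<xi>. \<forall>f \<in> F. \<tau> \<xi> = (\<alpha>, f) \<and> Dom C f = fst (s \<alpha>) \<longrightarrow>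
          (\<exists>g \<in> hom C (Cod C f) y. g \<cdot>\<^bsub>C\<^esub> f = h \<cdot>\<^bsub>C\<^esub> m \<alpha>))"
      proof (cases "\<exists>\<alpha> \<in> underS \<kappa> \<xi>. \<exists>f \<in> F. \<tau> \<xi> = (\<alpha>, f) \<and> Dom C f = fst (s \<alpha>)")
        case True
        then obtain \<alpha> f where \<alpha>: "\<alpha> \<in> underS \<kappa> \<xi>" "f \<in> F" "\<tau> \<xi> = (\<alpha>, f)" "Dom C f = fst (s \<alpha>)"
          by blast
        have f: "f \<in> hom C (fst (s \<alpha>)) (Cod C f)"
          using \<alpha> dom unfolding dominating_def hom_def by auto
        obtain y g h where "g \<in> hom C (Cod C f) y" "h \<in> hom C z y" "g \<cdot>\<^bsub>C\<^esub> f = h \<cdot>\<^bsub>C\<^esub> m \<alpha>"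
          using am f m[OF \<alpha>(1)] C.hom_Ob[OF f] z unfolding amalgamation_def by metis
        then show ?thesis using \<alpha> by fastforce
      next
        case False
        then show ?thesis using C.Idt_hom[OF z] by blast
      qed
      then obtain y h where h: "h \<in> hom C z y"
        and task: "\<And>\<alpha> f. \<alpha> \<in> underS \<kappa> \<xi> \<Longrightarrow> f \<in> F \<Longrightarrow> \<tau> \<xi> = (\<alpha>, f) \<Longrightarrow> Dom C f = fst (s \<alpha>) \<Longrightarrow>
          \<exists>g \<in> hom C (Cod C f) y. g \<cdot>\<^bsub>C\<^esub> f = h \<cdot>\<^bsub>C\<^esub> m \<alpha>" by blast
      obtain x e where x: "x \<in> Dom C ` F" and e: "e \<in> hom C y x"
        using dom C.hom_Ob[OF h] unfolding dominating_def by blast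
      have eh: "e \<cdot>\<^bsub>C\<^esub> h \<in> hom C z x" using C.Cmp_hom[OF h e] .
      define r where "r = (x, \<lambda>i. if i = \<xi> then Idt C x else (e \<cdot>\<^bsub>C\<^esub> h) \<cdot>\<^bsub>C\<^esub> m i)"
      have ri: "snd r i = (e \<cdot>\<^bsub>C\<^esub> h) \<cdot>\<^bsub>C\<^esub> m i" if "i \<in> underS \<kappa> \<xi>" for i
        using that by (auto simp: r_def underS_def)
      have "P s \<xi> r"
        unfolding P_def
      proof (intro impI conjI ballI allI)
        show "fst r \<in> Dom C ` F" "snd r \<xi> = Idt C (fst r)" using x by (simp_all add: r_def)
        show "snd r i \<in> hom C (fst (s i)) (fst r)" if "i \<in> underS \<kappa> \<xi>" for i
          using C.Cmp_hom[OF m[OF that] eh] ri[OF that] by (simp add: r_def)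
        show "snd r j \<cdot>\<^bsub>C\<^esub> snd (s j) i = snd r i" if j: "j \<in> underS \<kappa> \<xi>" and ij: "(i, j) \<in> \<kappa>" for i j
        proof -
          have i: "i \<in> underS \<kappa> \<xi>" using underS_downward_closed[OF w ij j] .
          show ?thesis
            using C.Cmp_assoc[OF P_hom[OF IH[OF j] ij] m[OF j] eh] mm[OF j ij] ri[OF i] ri[OF j]
            by simp
        qed
        fix \<alpha> f assume \<alpha>: "\<alpha> \<in> underS \<kappa> \<xi>" and f: "f \<in> F" and t: "\<tau> \<xi> = (\<alpha>, f) \<and> Dom C f = fst (s \<alpha>)"
        then obtain g where g: "g \<in> hom C (Cod C f) y" "g \<cdot>\<^bsub>C\<^esub> f = h \<cdot>\<^bsub>C\<^esub> m \<alpha>" using task by blast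
        have "f \<in> hom C (fst (s \<alpha>)) (Cod C f)"
          using f t dom unfolding dominating_def hom_def by auto
        then have "(e \<cdot>\<^bsub>C\<^esub> g) \<cdot>\<^bsub>C\<^esub> f = snd r \<alpha>"
          using C.Cmp_assoc g e h m[OF \<alpha>] ri[OF \<alpha>] by metis
        then show "\<exists>g \<in> hom C (Cod C f) (fst r). g \<cdot>\<^bsub>C\<^esub> f = snd r \<alpha>"
          using C.Cmp_hom[OF g(1) e] by (auto simp: r_def)
      qed
      then show ?thesis ..
    qed (simp add: P_def)
  qed
  then obtain s where s: "\<And>\<xi>. P s \<xi> (s \<xi>)" by blast
  have "cat_chain \<kappa> C (?u s)"
    by (rule cat_chainI) (use P_Ob P_hom P_Idt P_Cmp s in auto)
  moreover have "\<exists>\<beta> g. (\<alpha>, \<beta>) \<in> \<kappa> \<and> g \<in> hom C y (fst (s \<beta>)) \<and> g \<cdot>\<^bsub>C\<^esub> f = snd (s \<beta>) \<alpha>"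
    if \<alpha>: "\<alpha> \<in> Field \<kappa>" and f: "f \<in> hom C (fst (s \<alpha>)) y" for \<alpha> y f
  proof -
    have "fst (s \<alpha>) \<in> Dom C ` F" using s[of \<alpha>] \<alpha> unfolding P_def by blast
    then obtain p where p: "p \<in> Arr C" "Dom C p = y" "p \<cdot>\<^bsub>C\<^esub> f \<in> F"
      using dom f C.hom_Ob[OF f] unfolding dominating_def by blast
    then have p': "p \<in> hom C y (Cod C p)" by (simp add: hom_def)
    have pf: "p \<cdot>\<^bsub>C\<^esub> f \<in> hom C (fst (s \<alpha>)) (Cod C p)" using C.Cmp_hom[OF f p'] .
    obtain \<xi> where \<xi>: "\<alpha> \<in> underS \<kappa> \<xi>" "\<tau> \<xi> = (\<alpha>, p \<cdot>\<^bsub>C\<^esub> f)" using \<tau> \<alpha> p(3) by blast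
    then have "\<xi> \<in> Field \<kappa>" "(\<alpha>, \<xi>) \<in> \<kappa>" by (auto simp: underS_def FieldI2)
    moreover obtain g where g: "g \<in> hom C (Cod C p) (fst (s \<xi>))" "g \<cdot>\<^bsub>C\<^esub> (p \<cdot>\<^bsub>C\<^esub> f) = snd (s \<xi>) \<alpha>"
      using s[of \<xi>] \<xi> p(3) pf \<open>\<xi> \<in> Field \<kappa>\<close> unfolding P_def hom_def by auto
    ultimately show ?thesis
      using C.Cmp_hom[OF p' g(1)] C.Cmp_assoc[OF f p' g(1)] by metis
  qed
  ultimately have "absorbing_chain \<kappa> C (?u s)" by (simp add: absorbing_chain_def)
  then show ?thesis ..
qed

section \<open>Colimits of chains of small objects\<close>

locale small_embedding = C: category C + D: category D
  for C :: "('o, 'a) cat" and D :: "('p, 'b) cat" +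
  fixes \<kappa> :: "'k rel" and i :: "('o, 'a, 'p, 'b) fctr"
  assumes Cinfinite: "Cinfinite \<kappa>" and embedding: "embedding C D i"
    and small: "a \<in> Ob C \<Longrightarrow> small_object \<kappa> D (Fo i a)"
begin

lemma Well_order_\<kappa>: "Well_order \<kappa>"
  using Cinfinite by (simp add: card_order_on_def)

lemmas \<kappa>_refl = Well_order_facts(1)[OF Well_order_\<kappa>]
  and \<kappa>_trans = Well_order_facts(2)[OF Well_order_\<kappa>]
  and \<kappa>_total = Well_order_facts(4)[OF Well_order_\<kappa>]
  and \<kappa>_wf = Well_order_facts(5)[OF Well_order_\<kappa>]

lemma Field_\<kappa>_nonempty: "Field \<kappa> \<noteq> {}"
  using Cinfinite by (auto simp: cinfinite_def)

lemma \<kappa>_upper: "j \<in> Field \<kappa> \<Longrightarrow> k \<in> Field \<kappa> \<Longrightarrow> \<exists>l. (j, l) \<in> \<kappa> \<and> (k, l) \<in> \<kappa>"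
  using \<kappa>_total \<kappa>_refl by blast

lemma i_Ob: "a \<in> Ob C \<Longrightarrow> Fo i a \<in> Ob D"
  and i_hom: "f \<in> hom C a b \<Longrightarrow> Fa i f \<in> hom D (Fo i a) (Fo i b)"
  and i_Idt: "a \<in> Ob C \<Longrightarrow> Fa i (Idt C a) = Idt D (Fo i a)"
  and i_Cmp: "f \<in> hom C a b \<Longrightarrow> g \<in> hom C b c \<Longrightarrow> Fa i (g \<cdot>\<^bsub>C\<^esub> f) = Fa i g \<cdot>\<^bsub>D\<^esub> Fa i f"
  using embedding unfolding embedding_def is_functor_def by blast+

lemma i_full:
  assumes "h \<in> hom D (Fo i a) (Fo i b)" "a \<in> Ob C" "b \<in> Ob C"
  obtains h' where "h' \<in> hom C a b" "Fa i h' = h"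
  using assms embedding unfolding embedding_def full_def by blast

lemma i_faithful: "f \<in> hom C a b \<Longrightarrow> g \<in> hom C a b \<Longrightarrow> Fa i f = Fa i g \<Longrightarrow> f = g"
  using embedding C.hom_Ob unfolding embedding_def faithful_def by (meson inj_onD)

end

locale chain_colimit = small_embedding C D \<kappa> i
  for C :: "('o, 'a) cat" and D :: "('p, 'b) cat" and \<kappa> :: "'k rel" and i +
  fixes U :: "('k, 'k \<times> 'k, 'o, 'a) fctr" and x :: 'p and \<mu> :: "'k \<Rightarrow> 'b"
  assumes chain: "cat_chain \<kappa> C U"
    and colim: "is_colimit (poset_cat \<kappa>) D (comp_functor i U) x \<mu>"
begin

lemmas U_Ob = cat_chainD(1)[OF chain] and U_hom = cat_chainD(2)[OF chain]
  and U_Idt = cat_chainD(3)[OF chain] and U_Cmp = cat_chainD(4)[OF chain]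

lemma iU_Cmp: "(j, k) \<in> \<kappa> \<Longrightarrow> (k, l) \<in> \<kappa> \<Longrightarrow>
    Fa i (Fa U (k, l)) \<cdot>\<^bsub>D\<^esub> Fa i (Fa U (j, k)) = Fa i (Fa U (j, l))"
  using i_Cmp[OF U_hom U_hom] U_Cmp by simp

lemma chain_D: "cat_chain \<kappa> D (comp_functor i U)"
  using is_functor_comp_functor chain embedding unfolding cat_chain_def embedding_def by blast

lemma x_Ob: "x \<in> Ob D"
  and \<mu>_hom: "j \<in> Field \<kappa> \<Longrightarrow> \<mu> j \<in> hom D (Fo i (Fo U j)) x"
  and \<mu>_compat: "(j, k) \<in> \<kappa> \<Longrightarrow> \<mu> k \<cdot>\<^bsub>D\<^esub> Fa i (Fa U (j, k)) = \<mu> j"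
  using colim by (auto simp: is_colimit_def cocone_poset_cat_iff comp_functor_def)

lemma induced:
  assumes "y \<in> Ob D" "\<And>j. j \<in> Field \<kappa> \<Longrightarrow> t j \<in> hom D (Fo i (Fo U j)) y"
    and "\<And>j k. (j, k) \<in> \<kappa> \<Longrightarrow> t k \<cdot>\<^bsub>D\<^esub> Fa i (Fa U (j, k)) = t j"
  obtains h where "h \<in> hom D x y" "\<And>j. j \<in> Field \<kappa> \<Longrightarrow> h \<cdot>\<^bsub>D\<^esub> \<mu> j = t j"
proof -
  have "cocone (poset_cat \<kappa>) D (comp_functor i U) y t"
    using assms by (auto simp: cocone_poset_cat_iff comp_functor_def)
  then show ?thesis using that colim unfolding is_colimit_def poset_cat_simps by blast
qed

lemma eqI:
  assumes "h \<in> hom D x y" "h' \<in> hom D x y" "\<And>j. j \<in> Field \<kappa> \<Longrightarrow> h \<cdot>\<^bsub>D\<^esub> \<mu> j = h' \<cdot>\<^bsub>D\<^esub> \<mu> j"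
  shows "h = h'"
  using colimit_arrow_eqI[OF category_poset_cat_Well_order[OF Well_order_\<kappa>] D.category_axioms _ colim]
    chain_D assms unfolding cat_chain_def poset_cat_simps by blast

lemma compose_\<mu>:
  assumes "f \<in> hom C a (Fo U j)" "(j, k) \<in> \<kappa>"
  shows "Fa U (j, k) \<cdot>\<^bsub>C\<^esub> f \<in> hom C a (Fo U k)" "\<mu> k \<cdot>\<^bsub>D\<^esub> Fa i (Fa U (j, k) \<cdot>\<^bsub>C\<^esub> f) = \<mu> j \<cdot>\<^bsub>D\<^esub> Fa i f"
proof -
  show "Fa U (j, k) \<cdot>\<^bsub>C\<^esub> f \<in> hom C a (Fo U k)" using C.Cmp_hom[OF assms(1) U_hom[OF assms(2)]] .
  show "\<mu> k \<cdot>\<^bsub>D\<^esub> Fa i (Fa U (j, k) \<cdot>\<^bsub>C\<^esub> f) = \<mu> j \<cdot>\<^bsub>D\<^esub> Fa i f"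
    using D.Cmp_assoc[OF i_hom[OF assms(1)] i_hom[OF U_hom[OF assms(2)]] \<mu>_hom]
      i_Cmp[OF assms(1) U_hom[OF assms(2)]] \<mu>_compat[OF assms(2)] assms(2)
    by (simp add: FieldI2)
qed

lemma factor:
  assumes h: "h \<in> hom D (Fo i a) x" and a: "a \<in> Ob C" and \<alpha>: "\<alpha> \<in> Field \<kappa>"
  obtains j h' where "(\<alpha>, j) \<in> \<kappa>" "h' \<in> hom C a (Fo U j)" "\<mu> j \<cdot>\<^bsub>D\<^esub> Fa i h' = h"
proof -
  obtain k p where k: "k \<in> Field \<kappa>" "p \<in> hom D (Fo i a) (Fo (comp_functor i U) k)" "\<mu> k \<cdot>\<^bsub>D\<^esub> p = h"
    using small_object_factor[OF Well_order_\<kappa> D.category_axioms i_Ob[OF a] small[OF a] chain_D colim h]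
    by blast
  then obtain q where q: "q \<in> hom C a (Fo U k)" "Fa i q = p"
    using i_full[OF _ a U_Ob[OF k(1)]] by (auto simp: comp_functor_def)
  obtain j where j: "(\<alpha>, j) \<in> \<kappa>" "(k, j) \<in> \<kappa>" using \<kappa>_upper[OF \<alpha> k(1)] by blast
  show ?thesis using that[OF j(1)] compose_\<mu>[OF q(1) j(2)] q(2) k(3) by simp
qed

lemma equalize:
  assumes f: "f \<in> hom C a (Fo U j)" and g: "g \<in> hom C a (Fo U j)" and j: "j \<in> Field \<kappa>"
    and eq: "\<mu> j \<cdot>\<^bsub>D\<^esub> Fa i f = \<mu> j \<cdot>\<^bsub>D\<^esub> Fa i g"
  obtains k where "(j, k) \<in> \<kappa>" "Fa U (j, k) \<cdot>\<^bsub>C\<^esub> f = Fa U (j, k) \<cdot>\<^bsub>C\<^esub> g"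
proof -
  have a: "a \<in> Ob C" using C.hom_Ob f by blast
  obtain k where k: "(j, k) \<in> \<kappa>"
    and e: "Fa i (Fa U (j, k)) \<cdot>\<^bsub>D\<^esub> Fa i f = Fa i (Fa U (j, k)) \<cdot>\<^bsub>D\<^esub> Fa i g"
    using small_object_equalize[OF Well_order_\<kappa> D.category_axioms i_Ob[OF a] small[OF a] chain_D colim j,
        of "Fa i f" "Fa i g"] i_hom[OF f] i_hom[OF g] eq
    by (auto simp: comp_functor_def)
  have "Fa U (j, k) \<cdot>\<^bsub>C\<^esub> f = Fa U (j, k) \<cdot>\<^bsub>C\<^esub> g"
    using e i_Cmp[OF f U_hom[OF k]] i_Cmp[OF g U_hom[OF k]]
      i_faithful[OF C.Cmp_hom[OF f U_hom[OF k]] C.Cmp_hom[OF g U_hom[OF k]]] by simp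
  then show ?thesis using that k by blast
qed

lemma factor_pair:
  assumes "h1 \<in> hom D (Fo i a) x" "a \<in> Ob C" "h2 \<in> hom D (Fo i b) x" "b \<in> Ob C"
  obtains j f1 f2 where "j \<in> Field \<kappa>" "f1 \<in> hom C a (Fo U j)" "\<mu> j \<cdot>\<^bsub>D\<^esub> Fa i f1 = h1"
    "f2 \<in> hom C b (Fo U j)" "\<mu> j \<cdot>\<^bsub>D\<^esub> Fa i f2 = h2"
proof -
  obtain \<alpha> where "\<alpha> \<in> Field \<kappa>" using Field_\<kappa>_nonempty by blast
  then obtain k f1 where k: "(\<alpha>, k) \<in> \<kappa>" "f1 \<in> hom C a (Fo U k)" "\<mu> k \<cdot>\<^bsub>D\<^esub> Fa i f1 = h1"
    by (rule factor[OF assms(1,2)])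
  obtain j f2 where j: "(k, j) \<in> \<kappa>" "f2 \<in> hom C b (Fo U j)" "\<mu> j \<cdot>\<^bsub>D\<^esub> Fa i f2 = h2"
    by (rule factor[OF assms(3,4) FieldI2[OF k(1)]])
  show ?thesis
    by (rule that[OF FieldI2[OF j(1)] compose_\<mu>(1)[OF k(2) j(1)] _ j(2,3)])
      (simp add: compose_\<mu>(2)[OF k(2) j(1)] k(3))
qed

text \<open>An arrow \<open>\<chi>\<close> from \<open>a\<close> to the colimit lives at some stage \<open>U\<^sub>k\<close>; amalgamating it there
  with \<open>j : a \<rightarrow> b\<close> gives an arrow out of \<open>U\<^sub>k\<close>, which the chain absorbs.\<close>

theorem homogeneous_if_absorbing:
  assumes ab: "absorbing_chain \<kappa> C U" and am: "amalgamation C"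
  shows "homogeneous C D i x"
  unfolding homogeneous_def
proof (intro ballI)
  fix a b j \<chi> assume a: "a \<in> Ob C" and b: "b \<in> Ob C" and j: "j \<in> hom C a b"
    and \<chi>: "\<chi> \<in> hom D (Fo i a) x"
  obtain k p where k: "k \<in> Field \<kappa>" "p \<in> hom C a (Fo U k)" "\<mu> k \<cdot>\<^bsub>D\<^esub> Fa i p = \<chi>"
    by (rule factor_pair[OF \<chi> a \<chi> a])
  obtain d f g where f: "f \<in> hom C b d" and g: "g \<in> hom C (Fo U k) d" and fg: "f \<cdot>\<^bsub>C\<^esub> j = g \<cdot>\<^bsub>C\<^esub> p"
    using am[unfolded amalgamation_def, rule_format, OF a b U_Ob[OF k(1)] j k(2)] by blast
  obtain l h where l: "(k, l) \<in> \<kappa>" and h: "h \<in> hom C d (Fo U l)" and hg: "h \<cdot>\<^bsub>C\<^esub> g = Fa U (k, l)"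
    using ab k(1) g unfolding absorbing_chain_def by blast
  have hf: "h \<cdot>\<^bsub>C\<^esub> f \<in> hom C b (Fo U l)" using C.Cmp_hom[OF f h] .
  have "(h \<cdot>\<^bsub>C\<^esub> f) \<cdot>\<^bsub>C\<^esub> j = Fa U (k, l) \<cdot>\<^bsub>C\<^esub> p"
    using C.Cmp_assoc[OF j f h] C.Cmp_assoc[OF k(2) g h] fg hg by simp
  then have "\<mu> l \<cdot>\<^bsub>D\<^esub> Fa i ((h \<cdot>\<^bsub>C\<^esub> f) \<cdot>\<^bsub>C\<^esub> j) = \<chi>" using compose_\<mu>(2)[OF k(2) l] k(3) by simp
  then have "(\<mu> l \<cdot>\<^bsub>D\<^esub> Fa i (h \<cdot>\<^bsub>C\<^esub> f)) \<cdot>\<^bsub>D\<^esub> Fa i j = \<chi>"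
    using D.Cmp_assoc[OF i_hom[OF j] i_hom[OF hf] \<mu>_hom] i_Cmp[OF j hf] FieldI2[OF l] by simp
  then show "\<exists>\<chi>' \<in> hom D (Fo i b) x. \<chi>' \<cdot>\<^bsub>D\<^esub> Fa i j = \<chi>"
    using D.Cmp_hom[OF i_hom[OF hf] \<mu>_hom[OF FieldI2[OF l]]] by blast
qed

theorem universal_if_absorbing:
  assumes ab: "absorbing_chain \<kappa> C U" and je: "joint_embedding C"
  shows "universal C D i x"
  unfolding universal_def
proof
  fix a assume a: "a \<in> Ob C"
  obtain \<alpha> where \<alpha>: "\<alpha> \<in> Field \<kappa>" using Field_\<kappa>_nonempty by blast
  obtain d f g where f: "f \<in> hom C a d" and g: "g \<in> hom C (Fo U \<alpha>) d"
    using je a U_Ob[OF \<alpha>] unfolding joint_embedding_def by blast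
  obtain l h where l: "(\<alpha>, l) \<in> \<kappa>" and h: "h \<in> hom C d (Fo U l)"
    using ab \<alpha> g unfolding absorbing_chain_def by blast
  show "hom D (Fo i a) x \<noteq> {}"
    using D.Cmp_hom[OF i_hom[OF C.Cmp_hom[OF f h]] \<mu>_hom[OF FieldI2[OF l]]] by blast
qed

text \<open>For the converse, \<open>x\<close> plays the amalgam: two arrows into \<open>x\<close> that agree on \<open>a\<close> come from a
  common stage of the chain, and by smallness they agree there after passing to a later one.\<close>

theorem amalgamation_if_homogeneous_universal:
  assumes hom: "homogeneous C D i x" and univ: "universal C D i x"
  shows "amalgamation C"
  unfolding amalgamation_def
proof (intro ballI)
  fix a b c f g assume a: "a \<in> Ob C" and b: "b \<in> Ob C" and c: "c \<in> Ob C"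
    and f: "f \<in> hom C a b" and g: "g \<in> hom C a c"
  obtain \<chi> where \<chi>: "\<chi> \<in> hom D (Fo i b) x" using univ b unfolding universal_def by blast
  obtain \<chi>' where \<chi>': "\<chi>' \<in> hom D (Fo i c) x" "\<chi>' \<cdot>\<^bsub>D\<^esub> Fa i g = \<chi> \<cdot>\<^bsub>D\<^esub> Fa i f"
    using hom a c g D.Cmp_hom[OF i_hom[OF f] \<chi>] unfolding homogeneous_def by blast
  obtain j p q where j: "j \<in> Field \<kappa>" and p: "p \<in> hom C b (Fo U j)" "\<mu> j \<cdot>\<^bsub>D\<^esub> Fa i p = \<chi>"
    and q: "q \<in> hom C c (Fo U j)" "\<mu> j \<cdot>\<^bsub>D\<^esub> Fa i q = \<chi>'"
    by (rule factor_pair[OF \<chi> b \<chi>'(1) c])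
  have "\<mu> j \<cdot>\<^bsub>D\<^esub> Fa i (p \<cdot>\<^bsub>C\<^esub> f) = \<mu> j \<cdot>\<^bsub>D\<^esub> Fa i (q \<cdot>\<^bsub>C\<^esub> g)"
    using D.Cmp_assoc[OF i_hom[OF f] i_hom[OF p(1)] \<mu>_hom[OF j]]
      D.Cmp_assoc[OF i_hom[OF g] i_hom[OF q(1)] \<mu>_hom[OF j]]
      i_Cmp[OF f p(1)] i_Cmp[OF g q(1)] p(2) q(2) \<chi>'(2) by simp
  then obtain k where k: "(j, k) \<in> \<kappa>"
    and e: "Fa U (j, k) \<cdot>\<^bsub>C\<^esub> (p \<cdot>\<^bsub>C\<^esub> f) = Fa U (j, k) \<cdot>\<^bsub>C\<^esub> (q \<cdot>\<^bsub>C\<^esub> g)"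
    by (rule equalize[OF C.Cmp_hom[OF f p(1)] C.Cmp_hom[OF g q(1)] j])
  then have "(Fa U (j, k) \<cdot>\<^bsub>C\<^esub> p) \<cdot>\<^bsub>C\<^esub> f = (Fa U (j, k) \<cdot>\<^bsub>C\<^esub> q) \<cdot>\<^bsub>C\<^esub> g"
    using C.Cmp_assoc[OF f p(1) U_hom[OF k]] C.Cmp_assoc[OF g q(1) U_hom[OF k]] by simp
  then show "\<exists>d \<in> Ob C. \<exists>f' \<in> hom C b d. \<exists>g' \<in> hom C c d. f' \<cdot>\<^bsub>C\<^esub> f = g' \<cdot>\<^bsub>C\<^esub> g"
    using compose_\<mu>(1)[OF p(1) k] compose_\<mu>(1)[OF q(1) k] U_Ob[OF FieldI2[OF k]] by blast
qed

theorem joint_embedding_if_universal: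
  assumes univ: "universal C D i x"
  shows "joint_embedding C"
  unfolding joint_embedding_def
proof (intro ballI)
  fix a b assume a: "a \<in> Ob C" and b: "b \<in> Ob C"
  then obtain \<chi> \<chi>' where \<chi>: "\<chi> \<in> hom D (Fo i a) x" "\<chi>' \<in> hom D (Fo i b) x"
    using univ unfolding universal_def by blast
  show "\<exists>c \<in> Ob C. hom C a c \<noteq> {} \<and> hom C b c \<noteq> {}"
    using factor_pair[OF \<chi>(1) a \<chi>(2) b] U_Ob by blast
qed

end

section \<open>Isomorphisms between homogeneous colimits\<close>

lemma constant_chain_colimit:
  assumes r: "Well_order r" "Field r \<noteq> {}" and C: "category C" and x: "x \<in> Ob C"
    and F: "\<And>j. Fo F j = x" "\<And>e. Fa F e = Idt C x"
  shows "is_colimit (poset_cat r) C F x (\<lambda>_. Idt C x)"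
proof -
  interpret C: category C by fact
  have Idt: "Idt C x \<in> hom C x x" using C.Idt_hom[OF x] .
  have "\<exists>!h. h \<in> hom C x y \<and> (\<forall>j \<in> Field r. h \<cdot>\<^bsub>C\<^esub> Idt C x = \<nu> j)"
    if cc: "cocone (poset_cat r) C F y \<nu>" for y \<nu>
  proof -
    have \<nu>: "\<nu> j \<in> hom C x y" if "j \<in> Field r" for j
      using cc that F by (auto simp: cocone_poset_cat_iff)
    have step: "\<nu> k = \<nu> j" if "(j, k) \<in> r" for j k
    proof -
      have "\<nu> k \<cdot>\<^bsub>C\<^esub> Idt C x = \<nu> j" using cc that F unfolding cocone_poset_cat_iff by metis
      then show ?thesis using C.Cmp_Idt[OF \<nu>[OF FieldI2[OF that]]] by simp
    qed
    obtain j0 where j0: "j0 \<in> Field r" using r by blast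
    have "\<nu> j = \<nu> j0" if "j \<in> Field r" for j
      using Well_order_facts(4)[OF r(1) that j0] step by metis
    then show ?thesis using \<nu>[OF j0] C.Cmp_Idt j0 by metis
  qed
  then show ?thesis
    using x Idt C.Cmp_Idt[OF Idt] F
    by (simp add: is_colimit_def cocone_poset_cat_iff poset_cat_simps)
qed

context small_embedding
begin

text \<open>Constant chains show this. It makes the hypothesis that the arrows between colimits of
  continuous chains are monic apply to the colimit arrows \<open>\<mu>\<^sub>j\<close> as well, and to test arrows that
  start in \<open>C\<close>.\<close>

lemma i_Ob_cont_chain_colim_subcat:
  assumes a: "a \<in> Ob C"
  shows "Fo i a \<in> Ob (cont_chain_colim_subcat \<kappa> C D i)"
proof -
  let ?u = "\<lparr>Fo = \<lambda>_. a, Fa = \<lambda>_. Idt C a\<rparr> :: ('k, 'k \<times> 'k, 'o, 'a) fctr"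
  have "continuous_chain \<kappa> C ?u"
    unfolding continuous_chain_def
  proof (intro conjI allI impI)
    show "cat_chain \<kappa> C ?u"
      by (rule cat_chainI) (simp_all add: a C.Idt_hom C.Cmp_Idt[OF C.Idt_hom])
    fix j assume "limit_elem \<kappa> j"
    then have "underS \<kappa> j \<noteq> {}" by (simp add: limit_elem_def)
    then have "is_colimit (poset_cat (Restr \<kappa> (underS \<kappa> j))) C ?u a (\<lambda>_. Idt C a)"
      using a Field_Restr_underS[OF Well_order_\<kappa>]
      by (intro constant_chain_colimit Well_order_Restr[OF Well_order_\<kappa>] C.category_axioms) simp_all
    then show "is_colimit (poset_cat (Restr \<kappa> (underS \<kappa> j))) C ?u (Fo ?u j) (\<lambda>k. Fa ?u (k, j))"
      by simp
  qed
  moreover have "is_colimit (poset_cat \<kappa>) D (comp_functor i ?u) (Fo i a) (\<lambda>_. Idt D (Fo i a))"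
    using a Field_\<kappa>_nonempty i_Ob i_Idt
    by (intro constant_chain_colimit Well_order_\<kappa> D.category_axioms) (simp_all add: comp_functor_def)
  ultimately show ?thesis
    using i_Ob[OF a] unfolding cont_chain_colim_subcat_def by auto
qed

end

locale homogeneous_colimits =
  U: chain_colimit C D \<kappa> i U x \<mu> + V: chain_colimit C D \<kappa> i V y \<nu>
  for C :: "('o, 'a) cat" and D :: "('p, 'b) cat" and \<kappa> :: "'k rel" and i U x \<mu> V y \<nu> +
  assumes regular: "regularCard \<kappa>" and continuous: "continuous_chain \<kappa> C U"
    and x_K: "x \<in> Ob (cont_chain_colim_subcat \<kappa> C D i)"
    and y_K: "y \<in> Ob (cont_chain_colim_subcat \<kappa> C D i)"
    and all_monic: "\<And>m. m \<in> Arr (cont_chain_colim_subcat \<kappa> C D i) \<Longrightarrow>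
      monic (cont_chain_colim_subcat \<kappa> C D i) m"
    and x_homogeneous: "homogeneous C D i x" and y_homogeneous: "homogeneous C D i y"
begin

lemma cancel_left:
  assumes "m \<in> hom D p q" "f \<in> hom D r p" "g \<in> hom D r p" "m \<cdot>\<^bsub>D\<^esub> f = m \<cdot>\<^bsub>D\<^esub> g"
    and "p \<in> Ob (cont_chain_colim_subcat \<kappa> C D i)" "q \<in> Ob (cont_chain_colim_subcat \<kappa> C D i)"
      "r \<in> Ob (cont_chain_colim_subcat \<kappa> C D i)"
  shows "f = g"
proof -
  have "m \<in> Arr (cont_chain_colim_subcat \<kappa> C D i)"
    using assms unfolding cont_chain_colim_subcat_def by (auto simp: hom_def)
  then have "monic (cont_chain_colim_subcat \<kappa> C D i) m" by (rule all_monic)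
  moreover have "f \<in> hom (cont_chain_colim_subcat \<kappa> C D i) r p"
    "g \<in> hom (cont_chain_colim_subcat \<kappa> C D i) r p"
    using assms unfolding cont_chain_colim_subcat_def by (auto simp: hom_def)
  moreover have "Dom (cont_chain_colim_subcat \<kappa> C D i) m = p"
    "Cmp (cont_chain_colim_subcat \<kappa> C D i) = Cmp D"
    using assms(1) by (simp_all add: cont_chain_colim_subcat_def hom_def)
  ultimately show ?thesis using assms(4) unfolding monic_def by metis
qed

text \<open>Partial maps \<open>(\<alpha>, f)\<close> are the approximations to an arrow \<open>x \<rightarrow> y\<close>: a family of them, directed
  under prolongation and with \<open>\<alpha>\<close> cofinal in \<open>\<kappa>\<close>, induces such an arrow on the colimit \<open>x\<close> of \<open>U\<close>.\<close>

definition partial_map :: "'k \<times> 'b \<Rightarrow> bool" where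
  "partial_map p \<longleftrightarrow> fst p \<in> Field \<kappa> \<and> snd p \<in> hom D (Fo i (Fo U (fst p))) y"

definition prolonged_by :: "'k \<times> 'b \<Rightarrow> 'k \<times> 'b \<Rightarrow> bool" where
  "prolonged_by p q \<longleftrightarrow> (fst p, fst q) \<in> \<kappa> \<and> snd q \<cdot>\<^bsub>D\<^esub> Fa i (Fa U (fst p, fst q)) = snd p"

lemma restrict_assoc:
  assumes "f \<in> hom D (Fo i (Fo U l)) z" "(j, k) \<in> \<kappa>" "(k, l) \<in> \<kappa>"
  shows "(f \<cdot>\<^bsub>D\<^esub> Fa i (Fa U (k, l))) \<cdot>\<^bsub>D\<^esub> Fa i (Fa U (j, k)) = f \<cdot>\<^bsub>D\<^esub> Fa i (Fa U (j, l))"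
  using U.D.Cmp_assoc[OF U.i_hom[OF U.U_hom[OF assms(2)]] U.i_hom[OF U.U_hom[OF assms(3)]] assms(1)]
    U.iU_Cmp[OF assms(2,3)] by simp

lemma restrict_Idt: "partial_map p \<Longrightarrow> snd p \<cdot>\<^bsub>D\<^esub> Fa i (Fa U (fst p, fst p)) = snd p"
  using U.D.Cmp_Idt by (auto simp: partial_map_def U.U_Idt U.i_Idt U.U_Ob)

lemma prolonged_by_refl: "partial_map p \<Longrightarrow> prolonged_by p p"
  using restrict_Idt by (auto simp: prolonged_by_def partial_map_def U.\<kappa>_refl)

lemma prolonged_by_restrict:
  assumes "prolonged_by p q" "partial_map q" "(j, fst p) \<in> \<kappa>"
  shows "snd q \<cdot>\<^bsub>D\<^esub> Fa i (Fa U (j, fst q)) = snd p \<cdot>\<^bsub>D\<^esub> Fa i (Fa U (j, fst p))"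
  using assms restrict_assoc[of "snd q" "fst q" y j "fst p"]
  by (auto simp: prolonged_by_def partial_map_def)

lemma prolonged_by_trans:
  assumes "prolonged_by p q" "prolonged_by q r" "partial_map r"
  shows "prolonged_by p r"
  using assms prolonged_by_restrict[of q r "fst p"] U.\<kappa>_trans
  unfolding prolonged_by_def by metis

text \<open>At a limit the continuity of \<open>U\<close> is used. It speaks of colimits in \<open>C\<close>, whereas the partial
  maps to be glued lead to \<open>y\<close>. But there are fewer than \<open>\<kappa>\<close> of them, so that by regularity they
  all factor through a single stage \<open>V\<^sub>\<beta>\<close>; as \<open>V\<^sub>\<beta> \<rightarrow> y\<close> is monic, the factors are compatible.\<close>

lemma partial_maps_upper_bound:
  assumes S: "S \<noteq> {}" "|S| <o \<kappa>" "\<And>p. p \<in> S \<Longrightarrow> partial_map p"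
    and tot: "\<And>p q. p \<in> S \<Longrightarrow> q \<in> S \<Longrightarrow> prolonged_by p q \<or> prolonged_by q p"
  obtains t where "partial_map t" "\<And>p. p \<in> S \<Longrightarrow> prolonged_by p t"
proof -
  have small_image: "|f ` S| <o \<kappa>" for f :: "'k \<times> 'b \<Rightarrow> 'k"
    using card_of_image S(2) by (rule ordLeq_ordLess_trans)
  define B where "B = {\<beta> \<in> Field \<kappa>. \<forall>p \<in> S. (fst p, \<beta>) \<in> \<kappa>}"
  have "fst ` S \<subseteq> Field \<kappa>" using S(3) by (auto simp: partial_map_def)
  then obtain \<delta>0 where "\<delta>0 \<in> B"
    using regularCard_bounded[OF U.Cinfinite regular _ small_image] by (fastforce simp: B_def)
  then obtain \<delta> where \<delta>: "\<delta> \<in> B" and least: "\<And>z. (z, \<delta>) \<in> \<kappa> - Id \<Longrightarrow> z \<notin> B"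
    by (rule wfE_min[OF U.\<kappa>_wf]) blast
  have \<delta>F: "\<delta> \<in> Field \<kappa>" and S\<delta>: "\<And>p. p \<in> S \<Longrightarrow> (fst p, \<delta>) \<in> \<kappa>" using \<delta> by (auto simp: B_def)
  \<comment> \<open>So \<open>\<delta>\<close> is the supremum of the stages on which the members of \<open>S\<close> are defined.\<close>
  show ?thesis
  proof (cases "\<exists>s \<in> S. fst s = \<delta>")
    case True
    then obtain s where s: "s \<in> S" "fst s = \<delta>" by blast
    have "prolonged_by p s" if p: "p \<in> S" for p
    proof (cases "prolonged_by p s")
      case False
      then have sp: "prolonged_by s p" using tot[OF s(1) p] by blast
      then have "fst p = fst s"
        using S\<delta>[OF p] s(2) Well_order_facts(3)[OF U.Well_order_\<kappa>] unfolding prolonged_by_def by metis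
      then have "p = s"
        using sp restrict_Idt[OF S(3)[OF p]] by (auto simp: prolonged_by_def prod_eq_iff)
      then show ?thesis using prolonged_by_refl[OF S(3)[OF p]] by simp
    qed
    then show ?thesis using that S(3)[OF s(1)] by blast
  next
    case False
    have Sund: "fst p \<in> underS \<kappa> \<delta>" if "p \<in> S" for p
      using False S\<delta>[OF that] that by (auto simp: underS_def)
    have below: "\<exists>s \<in> S. k \<in> underS \<kappa> (fst s)" if k: "k \<in> underS \<kappa> \<delta>" for k
    proof -
      have kF: "k \<in> Field \<kappa>" using k underS_Field by fastforce
      have "k \<notin> B" using least k by (auto simp: underS_def)
      then obtain s where s: "s \<in> S" "(fst s, k) \<notin> \<kappa>" using kF by (auto simp: B_def)
      then have "(k, fst s) \<in> \<kappa>" "k \<noteq> fst s"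
        using U.\<kappa>_total[OF kF, of "fst s"] U.\<kappa>_refl[OF kF] S(3)[OF s(1)]
        by (auto simp: partial_map_def)
      then show ?thesis using s(1) by (auto simp: underS_def)
    qed
    have "limit_elem \<kappa> \<delta>"
      unfolding limit_elem_def using \<delta>F S(1) Sund below by blast
    then have U_colim: "is_colimit (poset_cat (Restr \<kappa> (underS \<kappa> \<delta>))) C U (Fo U \<delta>) (\<lambda>k. Fa U (k, \<delta>))"
      using continuous by (simp add: continuous_chain_def)
    have "\<exists>j h. j \<in> Field \<kappa> \<and> h \<in> hom C (Fo U (fst p)) (Fo V j) \<and> \<nu> j \<cdot>\<^bsub>D\<^esub> Fa i h = snd p"
      if "p \<in> S" for p
    proof -
      have p: "fst p \<in> Field \<kappa>" "snd p \<in> hom D (Fo i (Fo U (fst p))) y"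
        using S(3)[OF that] by (auto simp: partial_map_def)
      obtain j h where "(fst p, j) \<in> \<kappa>" "h \<in> hom C (Fo U (fst p)) (Fo V j)" "\<nu> j \<cdot>\<^bsub>D\<^esub> Fa i h = snd p"
        by (rule V.factor[OF p(2) U.U_Ob[OF p(1)] p(1)])
      then show ?thesis using FieldI2 by fast
    qed
    then obtain j h where jh: "\<And>p. p \<in> S \<Longrightarrow> j p \<in> Field \<kappa>"
      "\<And>p. p \<in> S \<Longrightarrow> h p \<in> hom C (Fo U (fst p)) (Fo V (j p))"
      "\<And>p. p \<in> S \<Longrightarrow> \<nu> (j p) \<cdot>\<^bsub>D\<^esub> Fa i (h p) = snd p" by metis
    have "j ` S \<subseteq> Field \<kappa>" using jh(1) by blast
    then have "\<exists>\<beta> \<in> Field \<kappa>. \<forall>k \<in> j ` S. (k, \<beta>) \<in> \<kappa>"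
      by (rule regularCard_bounded[OF U.Cinfinite regular _ small_image])
    then obtain \<beta> where \<beta>F: "\<beta> \<in> Field \<kappa>" and \<beta>: "\<And>p. p \<in> S \<Longrightarrow> (j p, \<beta>) \<in> \<kappa>" by auto
    define H where "H p = Fa V (j p, \<beta>) \<cdot>\<^bsub>C\<^esub> h p" for p
    have H: "H p \<in> hom C (Fo U (fst p)) (Fo V \<beta>)" "\<nu> \<beta> \<cdot>\<^bsub>D\<^esub> Fa i (H p) = snd p" if "p \<in> S" for p
      unfolding H_def using V.compose_\<mu>[OF jh(2)[OF that] \<beta>[OF that]] jh(3)[OF that] by simp_all
    obtain \<sigma> where \<sigma>: "\<And>k. k \<in> underS \<kappa> \<delta> \<Longrightarrow> \<sigma> k \<in> S \<and> k \<in> underS \<kappa> (fst (\<sigma> k))"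
      using below by metis
    have \<sigma>S: "\<sigma> k \<in> S" and k\<sigma>: "(k, fst (\<sigma> k)) \<in> \<kappa>" if "k \<in> underS \<kappa> \<delta>" for k
      using \<sigma>[OF that] by (auto simp: underS_def)
    define \<theta> where "\<theta> k = H (\<sigma> k) \<cdot>\<^bsub>C\<^esub> Fa U (k, fst (\<sigma> k))" for k
    have \<theta>_hom: "\<theta> k \<in> hom C (Fo U k) (Fo V \<beta>)" if "k \<in> underS \<kappa> \<delta>" for k
      unfolding \<theta>_def using U.C.Cmp_hom[OF U.U_hom[OF k\<sigma>[OF that]] H(1)[OF \<sigma>S[OF that]]] .
    have \<nu>\<theta>: "\<nu> \<beta> \<cdot>\<^bsub>D\<^esub> Fa i (\<theta> k) = snd p \<cdot>\<^bsub>D\<^esub> Fa i (Fa U (k, fst p))"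
      if k: "k \<in> underS \<kappa> \<delta>" and p: "p \<in> S" and kp: "(k, fst p) \<in> \<kappa>" for k p
    proof -
      let ?s = "\<sigma> k"
      note hs = H(1)[OF \<sigma>S[OF k]] and Uk = U.U_hom[OF k\<sigma>[OF k]]
      have "\<nu> \<beta> \<cdot>\<^bsub>D\<^esub> Fa i (\<theta> k) = snd ?s \<cdot>\<^bsub>D\<^esub> Fa i (Fa U (k, fst ?s))"
        unfolding \<theta>_def
        using U.i_Cmp[OF Uk hs] H(2)[OF \<sigma>S[OF k]]
          U.D.Cmp_assoc[OF U.i_hom[OF Uk] U.i_hom[OF hs] V.\<mu>_hom[OF \<beta>F]] by simp
      also have "\<dots> = snd p \<cdot>\<^bsub>D\<^esub> Fa i (Fa U (k, fst p))"
        using tot[OF p \<sigma>S[OF k]] prolonged_by_restrict S(3)[OF p] S(3)[OF \<sigma>S[OF k]] kp k\<sigma>[OF k]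
        by metis
      finally show ?thesis .
    qed
    have "cocone (poset_cat (Restr \<kappa> (underS \<kappa> \<delta>))) C U (Fo V \<beta>) \<theta>"
      unfolding cocone_poset_cat_iff Field_Restr_underS[OF U.Well_order_\<kappa>]
    proof (intro conjI ballI allI impI)
      show "Fo V \<beta> \<in> Ob C" using V.U_Ob[OF \<beta>F] .
      show "\<theta> k \<in> hom C (Fo U k) (Fo V \<beta>)" if "k \<in> underS \<kappa> \<delta>" for k using \<theta>_hom[OF that] .
      fix k l assume "(k, l) \<in> Restr \<kappa> (underS \<kappa> \<delta>)"
      then have kl: "(k, l) \<in> \<kappa>" and k: "k \<in> underS \<kappa> \<delta>" and l: "l \<in> underS \<kappa> \<delta>" by auto
      let ?p = "\<sigma> l"
      have p: "?p \<in> S" "(l, fst ?p) \<in> \<kappa>" "(k, fst ?p) \<in> \<kappa>"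
        using \<sigma>S[OF l] k\<sigma>[OF l] U.\<kappa>_trans[OF kl k\<sigma>[OF l]] by auto
      have p': "snd ?p \<in> hom D (Fo i (Fo U (fst ?p))) y" using S(3)[OF p(1)] by (simp add: partial_map_def)
      have comp: "\<theta> l \<cdot>\<^bsub>C\<^esub> Fa U (k, l) \<in> hom C (Fo U k) (Fo V \<beta>)"
        using U.C.Cmp_hom[OF U.U_hom[OF kl] \<theta>_hom[OF l]] .
      have "\<nu> \<beta> \<cdot>\<^bsub>D\<^esub> Fa i (\<theta> l \<cdot>\<^bsub>C\<^esub> Fa U (k, l)) = (\<nu> \<beta> \<cdot>\<^bsub>D\<^esub> Fa i (\<theta> l)) \<cdot>\<^bsub>D\<^esub> Fa i (Fa U (k, l))"
        using U.i_Cmp[OF U.U_hom[OF kl] \<theta>_hom[OF l]]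
          U.D.Cmp_assoc[OF U.i_hom[OF U.U_hom[OF kl]] U.i_hom[OF \<theta>_hom[OF l]] V.\<mu>_hom[OF \<beta>F]] by simp
      also have "\<dots> = snd ?p \<cdot>\<^bsub>D\<^esub> Fa i (Fa U (k, fst ?p))"
        using \<nu>\<theta>[OF l p(1,2)] restrict_assoc[OF p' kl p(2)] by simp
      also have "\<dots> = \<nu> \<beta> \<cdot>\<^bsub>D\<^esub> Fa i (\<theta> k)" using \<nu>\<theta>[OF k p(1,3)] by simp
      finally have "Fa i (\<theta> l \<cdot>\<^bsub>C\<^esub> Fa U (k, l)) = Fa i (\<theta> k)"
        by (rule cancel_left[OF V.\<mu>_hom[OF \<beta>F] U.i_hom[OF comp] U.i_hom[OF \<theta>_hom[OF k]]])
          (use U.i_Ob_cont_chain_colim_subcat y_K V.U_Ob[OF \<beta>F] U.U_Ob[OF FieldI1[OF kl]] in auto)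
      then show "\<theta> l \<cdot>\<^bsub>C\<^esub> Fa U (k, l) = \<theta> k" using U.i_faithful[OF comp \<theta>_hom[OF k]] by blast
    qed
    then obtain g where g: "g \<in> hom C (Fo U \<delta>) (Fo V \<beta>)"
      and g\<theta>: "\<And>k. k \<in> underS \<kappa> \<delta> \<Longrightarrow> g \<cdot>\<^bsub>C\<^esub> Fa U (k, \<delta>) = \<theta> k"
      using U_colim Field_Restr_underS[OF U.Well_order_\<kappa>]
      unfolding is_colimit_def poset_cat_simps by metis
    have "partial_map (\<delta>, \<nu> \<beta> \<cdot>\<^bsub>D\<^esub> Fa i g)"
      using \<delta>F U.D.Cmp_hom[OF U.i_hom[OF g] V.\<mu>_hom[OF \<beta>F]] by (simp add: partial_map_def)
    moreover have "prolonged_by p (\<delta>, \<nu> \<beta> \<cdot>\<^bsub>D\<^esub> Fa i g)" if p: "p \<in> S" for p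
    proof -
      note pd = S\<delta>[OF p]
      have pF: "(fst p, fst p) \<in> \<kappa>" using U.\<kappa>_refl FieldI1[OF pd] by blast
      have "(\<nu> \<beta> \<cdot>\<^bsub>D\<^esub> Fa i g) \<cdot>\<^bsub>D\<^esub> Fa i (Fa U (fst p, \<delta>)) = \<nu> \<beta> \<cdot>\<^bsub>D\<^esub> Fa i (\<theta> (fst p))"
        using U.i_Cmp[OF U.U_hom[OF pd] g] g\<theta>[OF Sund[OF p]]
          U.D.Cmp_assoc[OF U.i_hom[OF U.U_hom[OF pd]] U.i_hom[OF g] V.\<mu>_hom[OF \<beta>F]] by simp
      also have "\<dots> = snd p" using \<nu>\<theta>[OF Sund[OF p] p pF] restrict_Idt[OF S(3)[OF p]] by simp
      finally show ?thesis using pd by (simp add: prolonged_by_def)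
    qed
    ultimately show ?thesis using that by blast
  qed
qed

text \<open>Homogeneity is used twice, first of \<open>x\<close> and then of \<open>y\<close>. The map \<open>f\<close> is some
  \<open>h : U\<^sub>\<alpha> \<rightarrow> V\<^sub>\<beta>'\<close> followed by \<open>\<nu>\<^sub>\<beta>'\<close>; extending \<open>\<mu>\<^sub>\<alpha>\<close> along \<open>h\<close> embeds \<open>V\<^sub>\<beta>'\<close> into a later stage
  \<open>U\<^sub>\<alpha>'\<close>, and then \<open>\<nu>\<^sub>\<beta>'\<close> is extended along this embedding.\<close>

lemma partial_map_prolong:
  assumes p: "partial_map p" and \<beta>: "\<beta> \<in> Field \<kappa>"
  obtains q g where "partial_map q" "prolonged_by p q" "(\<beta>, fst q) \<in> \<kappa>"
    "g \<in> hom D (Fo i (Fo V \<beta>)) (Fo i (Fo U (fst q)))" "snd q \<cdot>\<^bsub>D\<^esub> g = \<nu> \<beta>"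
proof -
  obtain \<alpha> f where pp: "p = (\<alpha>, f)" and \<alpha>: "\<alpha> \<in> Field \<kappa>" and f: "f \<in> hom D (Fo i (Fo U \<alpha>)) y"
    using p by (cases p) (auto simp: partial_map_def)
  obtain \<beta>' h where \<beta>': "(\<beta>, \<beta>') \<in> \<kappa>" and h: "h \<in> hom C (Fo U \<alpha>) (Fo V \<beta>')" and \<nu>h: "\<nu> \<beta>' \<cdot>\<^bsub>D\<^esub> Fa i h = f"
    by (rule V.factor[OF f U.U_Ob[OF \<alpha>] \<beta>])
  have \<beta>'F: "\<beta>' \<in> Field \<kappa>" using FieldI2[OF \<beta>'] .
  note VOb = V.U_Ob[OF \<beta>'F] and UOb = U.U_Ob[OF \<alpha>] and \<nu>' = V.\<mu>_hom[OF \<beta>'F]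
  obtain e where e: "e \<in> hom D (Fo i (Fo V \<beta>')) x" and eh: "e \<cdot>\<^bsub>D\<^esub> Fa i h = \<mu> \<alpha>"
    using x_homogeneous UOb VOb h U.\<mu>_hom[OF \<alpha>] unfolding homogeneous_def by blast
  obtain \<gamma> where \<gamma>: "(\<alpha>, \<gamma>) \<in> \<kappa>" "(\<beta>, \<gamma>) \<in> \<kappa>" using U.\<kappa>_upper[OF \<alpha> \<beta>] by blast
  obtain \<alpha>' g where "(\<gamma>, \<alpha>') \<in> \<kappa>" and g: "g \<in> hom C (Fo V \<beta>') (Fo U \<alpha>')" and \<mu>g: "\<mu> \<alpha>' \<cdot>\<^bsub>D\<^esub> Fa i g = e"
    by (rule U.factor[OF e VOb FieldI2[OF \<gamma>(1)]])
  then have \<alpha>\<alpha>': "(\<alpha>, \<alpha>') \<in> \<kappa>" and \<beta>\<alpha>': "(\<beta>, \<alpha>') \<in> \<kappa>" using \<gamma> U.\<kappa>_trans by blast+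
  have \<alpha>'F: "\<alpha>' \<in> Field \<kappa>" using FieldI2[OF \<alpha>\<alpha>'] .
  have gh: "g \<cdot>\<^bsub>C\<^esub> h \<in> hom C (Fo U \<alpha>) (Fo U \<alpha>')" using U.C.Cmp_hom[OF h g] .
  have "\<mu> \<alpha>' \<cdot>\<^bsub>D\<^esub> Fa i (g \<cdot>\<^bsub>C\<^esub> h) = \<mu> \<alpha>' \<cdot>\<^bsub>D\<^esub> Fa i (Fa U (\<alpha>, \<alpha>'))"
    using U.i_Cmp[OF h g] U.D.Cmp_assoc[OF U.i_hom[OF h] U.i_hom[OF g] U.\<mu>_hom[OF \<alpha>'F]] \<mu>g eh
      U.\<mu>_compat[OF \<alpha>\<alpha>'] by simp
  then have ghU: "Fa i (g \<cdot>\<^bsub>C\<^esub> h) = Fa i (Fa U (\<alpha>, \<alpha>'))"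
    by (rule cancel_left[OF U.\<mu>_hom[OF \<alpha>'F] U.i_hom[OF gh] U.i_hom[OF U.U_hom[OF \<alpha>\<alpha>']]])
      (use U.i_Ob_cont_chain_colim_subcat x_K U.U_Ob[OF \<alpha>'F] UOb in auto)
  obtain f' where f': "f' \<in> hom D (Fo i (Fo U \<alpha>')) y" and f'g: "f' \<cdot>\<^bsub>D\<^esub> Fa i g = \<nu> \<beta>'"
    using y_homogeneous VOb U.U_Ob[OF \<alpha>'F] g \<nu>' unfolding homogeneous_def by blast
  have "f' \<cdot>\<^bsub>D\<^esub> Fa i (Fa U (\<alpha>, \<alpha>')) = f"
    using U.D.Cmp_assoc[OF U.i_hom[OF h] U.i_hom[OF g] f'] U.i_Cmp[OF h g] ghU f'g \<nu>h by simp
  then have "prolonged_by p (\<alpha>', f')" using \<alpha>\<alpha>' by (simp add: pp prolonged_by_def)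
  moreover have "partial_map (\<alpha>', f')" using f' \<alpha>'F by (simp add: partial_map_def)
  moreover note V' = U.i_hom[OF V.U_hom[OF \<beta>']]
  have "f' \<cdot>\<^bsub>D\<^esub> (Fa i g \<cdot>\<^bsub>D\<^esub> Fa i (Fa V (\<beta>, \<beta>'))) = \<nu> \<beta>"
    using U.D.Cmp_assoc[OF V' U.i_hom[OF g] f'] f'g V.\<mu>_compat[OF \<beta>'] by simp
  ultimately show ?thesis
    using that[of "(\<alpha>', f')"] \<beta>\<alpha>' U.D.Cmp_hom[OF V' U.i_hom[OF g]] by simp
qed

text \<open>The prolongations are iterated so that the \<open>\<xi>\<close>-th partial map is defined at least on \<open>U\<^sub>\<xi>\<close>
  and reaches \<open>V\<^sub>\<xi>\<close>. Their union \<open>k\<close> is then an arrow \<open>x \<rightarrow> y\<close> through which every \<open>\<nu>\<^sub>\<xi>\<close> factors;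
  as \<open>k\<close> is monic, the factors are compatible and make up its inverse. A symmetric back-and-forth
  is thus avoided.\<close>

lemma partial_map_extends_to_iso:
  assumes p0: "partial_map p0"
  obtains k where "k \<in> hom D x y" "is_iso D k" "k \<cdot>\<^bsub>D\<^esub> \<mu> (fst p0) = snd p0"
proof -
  define P where "P s \<xi> r \<longleftrightarrow> (\<xi> \<in> Field \<kappa> \<longrightarrow> partial_map r \<and> prolonged_by p0 r \<and>
      (\<forall>\<eta> \<in> underS \<kappa> \<xi>. prolonged_by (s \<eta>) r) \<and> (\<xi>, fst r) \<in> \<kappa> \<and>
      (\<exists>g \<in> hom D (Fo i (Fo V \<xi>)) (Fo i (Fo U (fst r))). snd r \<cdot>\<^bsub>D\<^esub> g = \<nu> \<xi>))"
    for s :: "'k \<Rightarrow> 'k \<times> 'b" and \<xi> r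
  have inf: "\<not> finite (Field \<kappa>)" and co: "Card_order \<kappa>"
    using U.Cinfinite by (auto simp: cinfinite_def)
  have uF: "\<eta> \<in> Field \<kappa>" if "\<eta> \<in> underS \<kappa> \<xi>" for \<eta> \<xi> using that underS_Field by fastforce
  have P_tot: "prolonged_by (s \<eta>) (s \<zeta>) \<or> prolonged_by (s \<zeta>) (s \<eta>)"
    if P: "P s \<eta> (s \<eta>)" "P s \<zeta> (s \<zeta>)" and F: "\<eta> \<in> Field \<kappa>" "\<zeta> \<in> Field \<kappa>" for s \<eta> \<zeta>
  proof (cases "\<eta> = \<zeta>")
    case True
    then show ?thesis using P F prolonged_by_refl unfolding P_def by blast
  next
    case False
    then have "\<eta> \<in> underS \<kappa> \<zeta> \<or> \<zeta> \<in> underS \<kappa> \<eta>" using U.\<kappa>_total[OF F] by (auto simp: underS_def)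
    then show ?thesis using P F unfolding P_def by blast
  qed
  have "\<exists>s. \<forall>\<xi>. P s \<xi> (s \<xi>)"
  proof (rule dependent_wf_choice[OF U.\<kappa>_wf])
    fix s s' :: "'k \<Rightarrow> 'k \<times> 'b" and \<xi> r
    assume eq: "\<And>z. (z, \<xi>) \<in> \<kappa> - Id \<Longrightarrow> s z = s' z"
    then have "\<forall>\<eta> \<in> underS \<kappa> \<xi>. s \<eta> = s' \<eta>" by (auto simp: underS_def)
    then show "P s \<xi> r = P s' \<xi> r" unfolding P_def by auto
  next
    fix \<xi> s assume "\<And>\<eta>. (\<eta>, \<xi>) \<in> \<kappa> - Id \<Longrightarrow> P s \<eta> (s \<eta>)"
    then have IH: "P s \<eta> (s \<eta>)" if "\<eta> \<in> underS \<kappa> \<xi>" for \<eta> using that by (auto simp: underS_def)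
    show "\<exists>r. P s \<xi> r"
    proof (cases "\<xi> \<in> Field \<kappa>")
      case True
      let ?S = "{p0} \<union> s ` underS \<kappa> \<xi>"
      have s: "partial_map (s \<eta>)" "prolonged_by p0 (s \<eta>)" if "\<eta> \<in> underS \<kappa> \<xi>" for \<eta>
        using IH[OF that] uF[OF that] by (auto simp: P_def)
      have "|s ` underS \<kappa> \<xi>| <o \<kappa>"
        using card_of_image card_of_underS[OF co True] by (rule ordLeq_ordLess_trans)
      moreover have "|{p0}| <o \<kappa>"
        using Cfinite_ordLess_Cinfinite[OF _ U.Cinfinite, of "|{p0}|"]
        by (auto simp: cfinite_def Field_card_of card_of_card_order_on)
      ultimately have "|?S| <o \<kappa>" using card_of_Un_ordLess_infinite_Field[OF inf co] by blast
      moreover have "partial_map p" if "p \<in> ?S" for p using that p0 s by blast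
      moreover have "prolonged_by p q \<or> prolonged_by q p" if "p \<in> ?S" "q \<in> ?S" for p q
        using that s(2) prolonged_by_refl[OF p0] P_tot[OF IH IH uF uF] by blast
      ultimately obtain t where t: "partial_map t" "\<And>p. p \<in> ?S \<Longrightarrow> prolonged_by p t"
        using partial_maps_upper_bound[of ?S] by blast
      obtain q g where q: "partial_map q" "prolonged_by t q" "(\<xi>, fst q) \<in> \<kappa>"
        "g \<in> hom D (Fo i (Fo V \<xi>)) (Fo i (Fo U (fst q)))" "snd q \<cdot>\<^bsub>D\<^esub> g = \<nu> \<xi>"
        by (rule partial_map_prolong[OF t(1) True])
      have "prolonged_by p q" if "p \<in> ?S" for p
        using prolonged_by_trans[OF t(2)[OF that] q(2,1)] .
      then have "P s \<xi> q" using q unfolding P_def by blast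
      then show ?thesis ..
    qed (simp add: P_def)
  qed
  then obtain s where s: "\<And>\<xi>. P s \<xi> (s \<xi>)" by blast
  have pm: "partial_map (s \<xi>)" and p0s: "prolonged_by p0 (s \<xi>)" and dom: "(\<xi>, fst (s \<xi>)) \<in> \<kappa>"
    if "\<xi> \<in> Field \<kappa>" for \<xi>
    using s[of \<xi>] that by (auto simp: P_def)
  define t where "t j = snd (s j) \<cdot>\<^bsub>D\<^esub> Fa i (Fa U (j, fst (s j)))" for j
  have t: "snd (s \<xi>) \<cdot>\<^bsub>D\<^esub> Fa i (Fa U (j, fst (s \<xi>))) = t j"
    if "j \<in> Field \<kappa>" "\<xi> \<in> Field \<kappa>" "(j, fst (s \<xi>)) \<in> \<kappa>" for j \<xi>
    using P_tot[OF s s that(1,2)] prolonged_by_restrict pm[OF that(1)] pm[OF that(2)]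
      dom[OF that(1)] that(3) unfolding t_def by metis
  have t_hom: "t j \<in> hom D (Fo i (Fo U j)) y" if "j \<in> Field \<kappa>" for j
    using U.D.Cmp_hom[OF U.i_hom[OF U.U_hom[OF dom[OF that]]]] pm[OF that]
    by (simp add: t_def partial_map_def)
  have "t l \<cdot>\<^bsub>D\<^esub> Fa i (Fa U (j, l)) = t j" if jl: "(j, l) \<in> \<kappa>" for j l
  proof -
    have l: "l \<in> Field \<kappa>" using FieldI2[OF jl] .
    have "snd (s l) \<in> hom D (Fo i (Fo U (fst (s l)))) y" using pm[OF l] by (simp add: partial_map_def)
    from restrict_assoc[OF this jl dom[OF l]] show ?thesis
      using t[OF FieldI1[OF jl] l U.\<kappa>_trans[OF jl dom[OF l]]] unfolding t_def by simp
  qed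
  then obtain k where k: "k \<in> hom D x y" and k\<mu>: "\<And>j. j \<in> Field \<kappa> \<Longrightarrow> k \<cdot>\<^bsub>D\<^esub> \<mu> j = t j"
    using U.induced[OF V.x_Ob t_hom] by blast
  have ks: "k \<cdot>\<^bsub>D\<^esub> \<mu> (fst (s \<xi>)) = snd (s \<xi>)" if \<xi>: "\<xi> \<in> Field \<kappa>" for \<xi>
  proof -
    have a: "fst (s \<xi>) \<in> Field \<kappa>" using FieldI2[OF dom[OF \<xi>]] .
    show ?thesis using k\<mu>[OF a] t[OF a \<xi> U.\<kappa>_refl[OF a]] restrict_Idt[OF pm[OF \<xi>]] by simp
  qed
  have kp0: "k \<cdot>\<^bsub>D\<^esub> \<mu> (fst p0) = snd p0"
  proof -
    have a: "fst p0 \<in> Field \<kappa>" using p0 by (simp add: partial_map_def)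
    have "(fst p0, fst (s (fst p0))) \<in> \<kappa>" using dom[OF a] .
    then show ?thesis using k\<mu>[OF a] p0s[OF a] by (simp add: t_def prolonged_by_def)
  qed
  have "\<exists>\<gamma>. \<gamma> \<in> hom D (Fo i (Fo V \<xi>)) x \<and> k \<cdot>\<^bsub>D\<^esub> \<gamma> = \<nu> \<xi>" if \<xi>: "\<xi> \<in> Field \<kappa>" for \<xi>
  proof -
    obtain g where g: "g \<in> hom D (Fo i (Fo V \<xi>)) (Fo i (Fo U (fst (s \<xi>))))" "snd (s \<xi>) \<cdot>\<^bsub>D\<^esub> g = \<nu> \<xi>"
      using s[of \<xi>] \<xi> unfolding P_def by blast
    note m = U.\<mu>_hom[OF FieldI2[OF dom[OF \<xi>]]]
    show ?thesis
      using U.D.Cmp_hom[OF g(1) m] U.D.Cmp_assoc[OF g(1) m k] ks[OF \<xi>] g(2) by auto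
  qed
  then obtain \<gamma> where \<gamma>: "\<And>\<xi>. \<xi> \<in> Field \<kappa> \<Longrightarrow> \<gamma> \<xi> \<in> hom D (Fo i (Fo V \<xi>)) x"
    "\<And>\<xi>. \<xi> \<in> Field \<kappa> \<Longrightarrow> k \<cdot>\<^bsub>D\<^esub> \<gamma> \<xi> = \<nu> \<xi>" by metis
  have "\<gamma> \<zeta> \<cdot>\<^bsub>D\<^esub> Fa i (Fa V (\<xi>, \<zeta>)) = \<gamma> \<xi>" if "(\<xi>, \<zeta>) \<in> \<kappa>" for \<xi> \<zeta>
  proof -
    have F: "\<xi> \<in> Field \<kappa>" "\<zeta> \<in> Field \<kappa>" using FieldI1[OF that] FieldI2[OF that] by auto
    note V' = U.i_hom[OF V.U_hom[OF that]]
    have "k \<cdot>\<^bsub>D\<^esub> (\<gamma> \<zeta> \<cdot>\<^bsub>D\<^esub> Fa i (Fa V (\<xi>, \<zeta>))) = k \<cdot>\<^bsub>D\<^esub> \<gamma> \<xi>"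
      using U.D.Cmp_assoc[OF V' \<gamma>(1)[OF F(2)] k] \<gamma>(2)[OF F(1)] \<gamma>(2)[OF F(2)] V.\<mu>_compat[OF that] by simp
    then show ?thesis
      by (rule cancel_left[OF k U.D.Cmp_hom[OF V' \<gamma>(1)[OF F(2)]] \<gamma>(1)[OF F(1)]])
        (use x_K y_K U.i_Ob_cont_chain_colim_subcat V.U_Ob[OF F(1)] in auto)
  qed
  then obtain l where l: "l \<in> hom D y x" and l\<nu>: "\<And>\<xi>. \<xi> \<in> Field \<kappa> \<Longrightarrow> l \<cdot>\<^bsub>D\<^esub> \<nu> \<xi> = \<gamma> \<xi>"
    using V.induced[OF U.x_Ob \<gamma>(1)] by blast
  note Ix = U.D.Idt_hom[OF U.x_Ob] and Iy = U.D.Idt_hom[OF V.x_Ob]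
  have kl: "k \<cdot>\<^bsub>D\<^esub> l = Idt D y"
  proof (rule V.eqI[OF U.D.Cmp_hom[OF l k] Iy])
    fix j assume j: "j \<in> Field \<kappa>"
    show "(k \<cdot>\<^bsub>D\<^esub> l) \<cdot>\<^bsub>D\<^esub> \<nu> j = Idt D y \<cdot>\<^bsub>D\<^esub> \<nu> j"
      using U.D.Cmp_assoc[OF V.\<mu>_hom[OF j] l k] l\<nu>[OF j] \<gamma>(2)[OF j] U.D.Idt_Cmp[OF V.\<mu>_hom[OF j]]
      by simp
  qed
  have "k \<cdot>\<^bsub>D\<^esub> (l \<cdot>\<^bsub>D\<^esub> k) = k \<cdot>\<^bsub>D\<^esub> Idt D x"
    using U.D.Cmp_assoc[OF k l k] kl U.D.Idt_Cmp[OF k] U.D.Cmp_Idt[OF k] by simp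
  then have "l \<cdot>\<^bsub>D\<^esub> k = Idt D x"
    by (rule cancel_left[OF k U.D.Cmp_hom[OF k l] Ix]) (use x_K y_K in auto)
  then have "is_iso D k" using k l kl by (auto simp: is_iso_def hom_def)
  then show ?thesis using that k kp0 by blast
qed

theorem arrows_differ_by_iso:
  assumes a: "a \<in> Ob C" and \<chi>1: "\<chi>1 \<in> hom D (Fo i a) x" and \<chi>2: "\<chi>2 \<in> hom D (Fo i a) y"
  obtains k where "k \<in> hom D x y" "is_iso D k" "k \<cdot>\<^bsub>D\<^esub> \<chi>1 = \<chi>2"
proof -
  obtain \<alpha> p where \<alpha>: "\<alpha> \<in> Field \<kappa>" and p: "p \<in> hom C a (Fo U \<alpha>)" and \<mu>p: "\<mu> \<alpha> \<cdot>\<^bsub>D\<^esub> Fa i p = \<chi>1"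
    by (rule U.factor_pair[OF \<chi>1 a \<chi>1 a])
  obtain f where f: "f \<in> hom D (Fo i (Fo U \<alpha>)) y" and fp: "f \<cdot>\<^bsub>D\<^esub> Fa i p = \<chi>2"
    using y_homogeneous a U.U_Ob[OF \<alpha>] p \<chi>2 unfolding homogeneous_def by blast
  have "partial_map (\<alpha>, f)" using \<alpha> f by (simp add: partial_map_def)
  then obtain k where k: "k \<in> hom D x y" "is_iso D k" and k\<mu>: "k \<cdot>\<^bsub>D\<^esub> \<mu> \<alpha> = f"
    by (rule partial_map_extends_to_iso) simp
  have "k \<cdot>\<^bsub>D\<^esub> \<chi>1 = \<chi>2"
    using U.D.Cmp_assoc[OF U.i_hom[OF p] U.\<mu>_hom[OF \<alpha>] k(1)] k\<mu> \<mu>p fp by simp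
  then show ?thesis using that k by blast
qed

end

section \<open>Homogeneous universal objects and amalgamation\<close>

lemma exists_homogeneous_universal:
  assumes "small_embedding C D \<kappa> i" "has_chain_colimits \<kappa> C D i"
    and ne: "Ob C \<noteq> {}" and bd: "chain_bounded \<kappa> C" and am: "amalgamation C"
    and je: "joint_embedding C" and dom: "dominating C F" "|F| \<le>o \<kappa>"
  shows "\<exists>u \<in> Ob (chain_colim_subcat \<kappa> C D i). homogeneous C D i u \<and> universal C D i u"
proof -
  interpret small_embedding C D \<kappa> i by fact
  obtain U where U: "absorbing_chain \<kappa> C U"
    using exists_absorbing_chain[OF Cinfinite C.category_axioms ne bd am dom] by blast
  then have ch: "cat_chain \<kappa> C U" by (simp add: absorbing_chain_def)
  then obtain x \<mu> where x: "is_colimit (poset_cat \<kappa>) D (comp_functor i U) x \<mu>"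
    using assms(2) unfolding has_chain_colimits_def by blast
  interpret chain_colimit C D \<kappa> i U x \<mu> by unfold_locales (fact ch x)+
  have "x \<in> Ob (chain_colim_subcat \<kappa> C D i)"
    using x_Ob ch x by (auto simp: chain_colim_subcat_def)
  then show ?thesis
    using homogeneous_if_absorbing[OF U am] universal_if_absorbing[OF U je] by blast
qed

lemma exists_iso_extending:
  assumes emb: "small_embedding C D \<kappa> i" and reg: "regularCard \<kappa>"
    and mon: "\<forall>m \<in> Arr (cont_chain_colim_subcat \<kappa> C D i). monic (cont_chain_colim_subcat \<kappa> C D i) m"
    and u: "u \<in> Ob (cont_chain_colim_subcat \<kappa> C D i)" "homogeneous C D i u"
    and v: "v \<in> Ob (cont_chain_colim_subcat \<kappa> C D i)" "homogeneous C D i v"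
    and a: "a \<in> Ob C" "\<chi>1 \<in> hom D (Fo i a) u" "\<chi>2 \<in> hom D (Fo i a) v"
  obtains k where "k \<in> hom D u v" "is_iso D k" "k \<cdot>\<^bsub>D\<^esub> \<chi>1 = \<chi>2"
proof -
  interpret small_embedding C D \<kappa> i by fact
  obtain U \<mu> where U: "continuous_chain \<kappa> C U" "is_colimit (poset_cat \<kappa>) D (comp_functor i U) u \<mu>"
    using u(1) by (auto simp: cont_chain_colim_subcat_def)
  obtain V \<nu> where V: "continuous_chain \<kappa> C V" "is_colimit (poset_cat \<kappa>) D (comp_functor i V) v \<nu>"
    using v(1) by (auto simp: cont_chain_colim_subcat_def)
  interpret homogeneous_colimits C D \<kappa> i U u \<mu> V v \<nu>
    using U V reg mon u v by unfold_locales (auto simp: continuous_chain_def)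
  show ?thesis using arrows_differ_by_iso[OF a] that by blast
qed

lemma ultrahomogeneous_if_homogeneous:
  assumes emb: "small_embedding C D \<kappa> i" and "regularCard \<kappa>"
    and "\<forall>m \<in> Arr (cont_chain_colim_subcat \<kappa> C D i). monic (cont_chain_colim_subcat \<kappa> C D i) m"
    and "u \<in> Ob (cont_chain_colim_subcat \<kappa> C D i)" "homogeneous C D i u"
  shows "ultrahomogeneous C D i u"
  unfolding ultrahomogeneous_def
proof (intro ballI)
  interpret small_embedding C D \<kappa> i by fact
  fix a b j \<chi>1 \<chi>2 assume "a \<in> Ob C" "b \<in> Ob C" "j \<in> hom C a b" "\<chi>1 \<in> hom D (Fo i a) u"
    "\<chi>2 \<in> hom D (Fo i b) u"
  then show "\<exists>k \<in> hom D u u. is_iso D k \<and> k \<cdot>\<^bsub>D\<^esub> \<chi>1 = \<chi>2 \<cdot>\<^bsub>D\<^esub> Fa i j"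
    using exists_iso_extending[OF assms assms(4,5)] D.Cmp_hom[OF i_hom] by metis
qed

lemma homogeneous_universal_unique:
  assumes emb: "small_embedding C D \<kappa> i" and "regularCard \<kappa>" and ne: "Ob C \<noteq> {}"
    and "\<forall>m \<in> Arr (cont_chain_colim_subcat \<kappa> C D i). monic (cont_chain_colim_subcat \<kappa> C D i) m"
    and u: "u \<in> Ob (cont_chain_colim_subcat \<kappa> C D i)" "homogeneous C D i u" "universal C D i u"
    and v: "v \<in> Ob (cont_chain_colim_subcat \<kappa> C D i)" "homogeneous C D i v" "universal C D i v"
  shows "isomorphic (cont_chain_colim_subcat \<kappa> C D i) u v"
proof -
  obtain a \<chi>1 \<chi>2 where "a \<in> Ob C" "\<chi>1 \<in> hom D (Fo i a) u" "\<chi>2 \<in> hom D (Fo i a) v"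
    using ne u(3) v(3) unfolding universal_def by blast
  then obtain k where k: "k \<in> hom D u v" and iso: "is_iso D k"
    using exists_iso_extending[OF assms(1,2,4) u(1,2) v(1,2)] by metis
  \<comment> \<open>The subcategory is full, so the inverse of \<open>k\<close> lies in it as well.\<close>
  have hom: "hom (cont_chain_colim_subcat \<kappa> C D i) p q = hom D p q"
    if "p \<in> {u, v}" "q \<in> {u, v}" for p q
    using that u(1) v(1) unfolding cont_chain_colim_subcat_def by auto
  have "k \<in> hom (cont_chain_colim_subcat \<kappa> C D i) u v" using k hom by simp
  moreover obtain l where "l \<in> hom D v u" "l \<cdot>\<^bsub>D\<^esub> k = Idt D u" "k \<cdot>\<^bsub>D\<^esub> l = Idt D v"
    using iso k by (auto simp: is_iso_def hom_def)
  then have "l \<in> hom (cont_chain_colim_subcat \<kappa> C D i) v u" "l \<cdot>\<^bsub>D\<^esub> k = Idt D u" "k \<cdot>\<^bsub>D\<^esub> l = Idt D v"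
    using hom by simp_all
  ultimately show ?thesis
    unfolding isomorphic_def is_iso_def
    by (intro bexI[of _ k] conjI bexI[of _ l])
      (auto simp: hom_def cont_chain_colim_subcat_def)
qed

theorem theorem1p5:
  fixes \<kappa> :: "'k rel" and C :: "('o, 'a) cat"
  assumes "Cinfinite \<kappa>" and "regularCard \<kappa>" and "category C"
  shows
    "(Ob C \<noteq> {} \<and> chain_bounded \<kappa> C \<and> amalgamation C \<and> joint_embedding C \<and>
      (\<exists>\<F>. dominating C \<F> \<and> |\<F>| \<le>o \<kappa>) \<longrightarrow>
        (\<forall>(D :: ('p, 'b) cat) i.
          category D \<and> embedding C D i \<and> has_chain_colimits \<kappa> C D i \<and>
          (\<forall>a \<in> Ob C. small_object \<kappa> D (Fo i a)) \<longrightarrow>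
            (\<exists>u \<in> Ob (chain_colim_subcat \<kappa> C D i). homogeneous C D i u \<and> universal C D i u) \<and>
            ((\<forall>m \<in> Arr (cont_chain_colim_subcat \<kappa> C D i).
                monic (cont_chain_colim_subcat \<kappa> C D i) m) \<longrightarrow>
              (\<forall>u \<in> Ob (cont_chain_colim_subcat \<kappa> C D i).
                homogeneous C D i u \<and> universal C D i u \<longrightarrow>
                  ultrahomogeneous C D i u \<and>
                  (\<forall>v \<in> Ob (cont_chain_colim_subcat \<kappa> C D i).
                    homogeneous C D i v \<and> universal C D i v \<longrightarrow>
                      isomorphic (cont_chain_colim_subcat \<kappa> C D i) u v)))))
     \<and>
     (\<forall>(D :: ('p, 'b) cat) i.
        category D \<and> embedding C D i \<and> (\<forall>a \<in> Ob C. small_object \<kappa> D (Fo i a)) \<and>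
        (\<forall>m \<in> Arr (chain_colim_subcat \<kappa> C D i). monic (chain_colim_subcat \<kappa> C D i) m) \<and>
        (\<exists>u \<in> Ob (chain_colim_subcat \<kappa> C D i). homogeneous C D i u \<and> universal C D i u) \<longrightarrow>
          amalgamation C \<and> joint_embedding C)"
proof (intro conjI impI allI)
  fix D :: "('p, 'b) cat" and i
  assume A: "Ob C \<noteq> {} \<and> chain_bounded \<kappa> C \<and> amalgamation C \<and> joint_embedding C \<and>
      (\<exists>\<F>. dominating C \<F> \<and> |\<F>| \<le>o \<kappa>)"
    and B: "category D \<and> embedding C D i \<and> has_chain_colimits \<kappa> C D i \<and>
      (\<forall>a \<in> Ob C. small_object \<kappa> D (Fo i a))"
  then have emb: "small_embedding C D \<kappa> i"
    using assms by (simp add: small_embedding_def small_embedding_axioms_def)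
  show "\<exists>u \<in> Ob (chain_colim_subcat \<kappa> C D i). homogeneous C D i u \<and> universal C D i u"
    using exists_homogeneous_universal[OF emb] A B by blast
  assume mon: "\<forall>m \<in> Arr (cont_chain_colim_subcat \<kappa> C D i).
      monic (cont_chain_colim_subcat \<kappa> C D i) m"
  show "\<forall>u \<in> Ob (cont_chain_colim_subcat \<kappa> C D i).
      homogeneous C D i u \<and> universal C D i u \<longrightarrow>
        ultrahomogeneous C D i u \<and>
        (\<forall>v \<in> Ob (cont_chain_colim_subcat \<kappa> C D i).
          homogeneous C D i v \<and> universal C D i v \<longrightarrow>
            isomorphic (cont_chain_colim_subcat \<kappa> C D i) u v)"
    using ultrahomogeneous_if_homogeneous[OF emb assms(2) mon]
      homogeneous_universal_unique[OF emb assms(2) _ mon] A by blast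
next
  fix D :: "('p, 'b) cat" and i
  assume B: "category D \<and> embedding C D i \<and> (\<forall>a \<in> Ob C. small_object \<kappa> D (Fo i a)) \<and>
      (\<forall>m \<in> Arr (chain_colim_subcat \<kappa> C D i). monic (chain_colim_subcat \<kappa> C D i) m) \<and>
      (\<exists>u \<in> Ob (chain_colim_subcat \<kappa> C D i). homogeneous C D i u \<and> universal C D i u)"
  then have emb: "small_embedding C D \<kappa> i"
    using assms by (simp add: small_embedding_def small_embedding_axioms_def)
  obtain u U \<mu> where u: "homogeneous C D i u" "universal C D i u" and U: "cat_chain \<kappa> C U"
    "is_colimit (poset_cat \<kappa>) D (comp_functor i U) u \<mu>"
    using B by (auto simp: chain_colim_subcat_def)
  interpret chain_colimit C D \<kappa> i U u \<mu>
    using emb U by (simp add: chain_colimit_def chain_colimit_axioms_def)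
  show "amalgamation C" using amalgamation_if_homogeneous_universal[OF u] .
  show "joint_embedding C" using joint_embedding_if_universal[OF u(2)] .
qed

end
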